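(* Let $\mathcal P\subset\mathbb{R}^d$ be a rational polytope with denominator $p$, and let $\lambda$ be an integral form that is generic and positive with respect to $\mathcal P$. Then for each $0\le r<p$ there exists a polynomial $\chi_{\mathcal P}^{\lambda,r}(q,x)\in\mathbb{Q}(q)[x]$ such that $\chi_{\mathcal P}^{\lambda,r}(q,[k]_q)=\operatorname{ehr}_{\mathcal P}^\lambda(q,kp+r)$ for all integers $k\ge0$. The degree of $\chi_{\mathcal P}^{\lambda,r}(q,x)$ is $\max\{\lambda(p\mathbf v):\mathbf v\text{ vertex of }\mathcal P\}$, and each pole of a coefficient of $\chi_{\mathcal P}^{\lambda,r}(q,x)$ is an $n$th root of unity where $n=|\lambda(g(p(\mathbf w-\mathbf v)))|$ for some adjacent vertices $\mathbf v,\mathbf w$ of $\mathcal P$.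
   Context: A rational polytope is the convex hull of finitely many points of $\mathbb{Q}^d$; its denominator is the smallest positive integer $p$ such that $p\mathcal P$ has all vertices in $\mathbb{Z}^d$. Two vertices are adjacent if they form an edge. An integral form is $\lambda(\mathbf m)=\lambda_1m_1+\dots+\lambda_dm_d$ with $\lambda_j\in\mathbb{Z}$; it is generic and positive w.r.t. $\mathcal P$ if $\lambda(\mathbf v)\ne\lambda(\mathbf w)$ for adjacent vertices and $\lambda(\mathbf v)\ge0$ for all vertices. $[k]_q=\frac{q^k-1}{q-1}$ and $\operatorname{ehr}_{\mathcal P}^\lambda(q,t)=\sum_{\mathbf m\in t\mathcal P\cap\mathbb{Z}^d}q^{\lambda(\mathbf m)}$. For $\mathbf m\in\mathbb{Z}^d\setminus\{0\}$, $g(\mathbf m)$ is $\mathbf m$ divided by the gcd of its entries.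
   Formalization: The degree claim is stated only when the affine hull of rP contains a lattice point; otherwise the polynomial is zero (e.g. P={1/2}, λ=(1), p=2, r=1, where the claimed degree would be 1). This always holds for r=0 and for full-dimensional P. *)

theory Defs
  imports "HOL-Analysis.Analysis"
    "HOL-Computational_Algebra.Computational_Algebra"
    "HOL-Computational_Algebra.Field_as_Ring"
begin

section \<open>Rational polytopes\<close>

definition rvec :: "int ^ 'd \<Rightarrow> real ^ 'd" where
  "rvec m = (\<chi> j. of_int (m $ j))"

definition dilate :: "nat \<Rightarrow> (real ^ 'd) set \<Rightarrow> (real ^ 'd) set" where
  "dilate t P = (\<lambda>x. of_nat t *\<^sub>R x) ` P"

text \<open>Polytopes are nonempty, so that the maximum over all vertices is meaningful and
  \<open>dilate 0 P = {0}\<close>.\<close>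

definition rational_polytope :: "(real ^ 'd) set \<Rightarrow> bool" where
  "rational_polytope P \<longleftrightarrow>
     (\<exists>S. finite S \<and> S \<noteq> {} \<and> (\<forall>v\<in>S. \<forall>j. v $ j \<in> \<rat>) \<and> P = convex hull S)"

definition vertices :: "(real ^ 'd) set \<Rightarrow> (real ^ 'd) set" where
  "vertices P = {v. v extreme_point_of P}"

definition adjacent :: "(real ^ 'd) set \<Rightarrow> real ^ 'd \<Rightarrow> real ^ 'd \<Rightarrow> bool" where
  "adjacent P v w \<longleftrightarrow>
     v \<in> vertices P \<and> w \<in> vertices P \<and> closed_segment v w edge_of P"

definition denominator :: "(real ^ 'd) set \<Rightarrow> nat" where
  "denominator P = (LEAST p. p > 0 \<and> vertices (dilate p P) \<subseteq> range rvec)"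

section \<open>Integral forms\<close>

text \<open>A form is given by its integer coefficient vector. It is evaluated both at integer vectors
  (with integer values) and at real vectors (with real values).\<close>

definition form :: "int ^ 'd \<Rightarrow> 'a::comm_ring_1 ^ 'd \<Rightarrow> 'a" where
  "form l x = (\<Sum>j\<in>UNIV. of_int (l $ j) * x $ j)"

definition generic_form :: "(real ^ 'd) set \<Rightarrow> int ^ 'd \<Rightarrow> bool" where
  "generic_form P l \<longleftrightarrow> (\<forall>v w. adjacent P v w \<longrightarrow> form l v \<noteq> form l w)"

definition positive_form :: "(real ^ 'd) set \<Rightarrow> int ^ 'd \<Rightarrow> bool" where
  "positive_form P l \<longleftrightarrow> (\<forall>v\<in>vertices P. form l v \<ge> 0)"

definition primitive_vec :: "int ^ 'd \<Rightarrow> int ^ 'd" where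
  "primitive_vec m = (\<chi> j. m $ j div Gcd (range (\<lambda>i. m $ i)))"

section \<open>The field of rational functions in \<open>q\<close> and the \<open>q\<close>-Ehrhart function\<close>

type_synonym ratfun = "rat poly fract"

definition qvar :: ratfun where
  "qvar = Fract [:0, 1:] 1"

definition qint :: "nat \<Rightarrow> ratfun" where
  "qint k = (qvar ^ k - 1) / (qvar - 1)"

definition ehr :: "(real ^ 'd) set \<Rightarrow> int ^ 'd \<Rightarrow> nat \<Rightarrow> ratfun" where
  "ehr P l t = (\<Sum>m\<in>{m. rvec m \<in> dilate t P}. qvar powi form l m)"

text \<open>\<^const>\<open>quot_of_fract\<close> yields numerator and denominator in lowest terms, so the (finite,
  complex) poles are exactly the complex roots of its second component.\<close>

definition is_pole_of :: "complex \<Rightarrow> ratfun \<Rightarrow> bool" where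
  "is_pole_of z f \<longleftrightarrow> poly (map_poly of_rat (snd (quot_of_fract f))) z = 0"

section \<open>Lattice points in the affine hull of a dilate\<close>

text \<open>If the affine hull of \<open>r P\<close> contains no lattice point, then no dilate \<open>(k p + r) P\<close> does, and
  the polynomial interpolating \<open>ehr\<close> on this residue class is the zero polynomial (for instance
  \<open>P = {1/2}\<close> on the real line, \<open>p = 2\<close>, \<open>r = 1\<close>), whose degree is not given by the vertices.
  The following predicate excludes exactly this case. As the lemmas show, it always holds for
  full-dimensional polytopes and for \<open>r = 0\<close>.\<close>

definition affine_lattice_point :: "(real ^ 'd) set \<Rightarrow> nat \<Rightarrow> bool" where
  "affine_lattice_point P r \<longleftrightarrow> (\<exists>m. rvec m \<in> affine hull (dilate r P))"

lemma affine_lattice_point_0: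
  assumes "rational_polytope P"
  shows "affine_lattice_point P 0"
proof -
  from assms have "P \<noteq> {}"
    by (auto simp: rational_polytope_def)
  then have "dilate 0 P = {0}"
    by (auto simp: dilate_def)
  moreover have "rvec 0 = 0"
    by (simp add: rvec_def vec_eq_iff)
  ultimately show ?thesis
    unfolding affine_lattice_point_def by (metis affine_hull_sing singletonI)
qed

lemma affine_lattice_point_full_dim:
  assumes "rational_polytope P" and "interior P \<noteq> {}"
  shows "affine_lattice_point P r"
proof (cases "r = 0")
  case True
  then show ?thesis using affine_lattice_point_0 assms(1) by simp
next
  case False
  have "interior (dilate r P) = (\<lambda>x. of_nat r *\<^sub>R x) ` interior P"
    unfolding dilate_def using False
    by (intro interior_injective_linear_image) (auto simp: inj_on_def linear_scaleR)
  with assms(2) have "interior (dilate r P) \<noteq> {}" by simp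
  then have "affine hull (dilate r P) = UNIV"
    by (rule affine_hull_nonempty_interior)
  then show ?thesis by (simp add: affine_lattice_point_def)
qed

end

theory Submission
  imports Defs
begin

text \<open>Let \<open>C\<^sub>v\<close> be the tangent cone of \<open>P\<close> at the vertex \<open>v\<close>. By Brion's theorem the generating function
  of the lattice points of \<open>t P\<close> is the sum over \<open>v\<close> of those of \<open>t v + C\<^sub>v\<close>, which are rational
  functions with denominators \<open>1 - x\<^sup>u\<close> for the primitive edge directions \<open>u\<close> at \<open>v\<close>. As \<open>\<lambda>(u)\<close> is never
  zero, one may substitute \<open>x\<^sub>j = q\<close> to the power \<open>\<lambda>\<^sub>j\<close>. For \<open>t = k p + r\<close> the cone at \<open>v\<close> is the translate by
  \<open>k p v\<close> of the one for \<open>r\<close>, so it contributes \<open>\<rho>\<^sub>v(q)\<close> times \<open>q\<^sup>k = 1 + (q - 1) [k]\<^sub>q\<close> to the power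
  \<open>\<lambda>(p v)\<close>.

  Brion's theorem is stated for indicator functions on the lattice, with factors \<open>1 - x\<^sup>u\<close> acting
  as difference operators. The Hilbert--Serre theorem for the cone over \<open>P\<close> shows that the indicators
  of \<open>(k p + c) P\<close> satisfy a linear recurrence in \<open>k\<close> whose characteristic roots are the translations by
  the \<open>p v\<close>. After multiplication by Vandermonde factors they are therefore a combination of the \<open>k\<close>-th
  powers of these translations, and letting \<open>k\<close> grow near one vertex identifies the coefficients with the
  tangent cones. So the error in Brion's identity is a torsion element; after multiplication by all
  edge factors it also has finite support and hence vanishes.\<close>

section \<open>Difference operators and finitely generated lattice sets\<close>

text \<open>Natural multiples in an arbitrary abelian group: the calculus below is applied both to
  the lattice and to the lattice times the integers, where the last coordinate is the dilation
  factor.\<close>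

primrec nmul :: "nat \<Rightarrow> 'a::ab_group_add \<Rightarrow> 'a" where
  "nmul 0 u = 0"
| "nmul (Suc n) u = u + nmul n u"

lemma nmul_add: "nmul (m + n) u = nmul m u + nmul n u"
  by (induction m) (simp_all add: add.assoc)

lemma nmul_additive:
  assumes "\<And>x y. h (x + y) = h x + h y"
  shows "h (nmul n u) = of_nat n *\<^sub>R (h u :: 'b::real_vector)"
proof (induction n)
  case 0
  have "h 0 + h 0 = h 0 + 0"
    by (metis assms add.right_neutral)
  then show ?case by simp
qed (simp add: assms scaleR_left_distrib)

lemma nmul_component: "nmul n (u :: int ^ 'd) $ i = int n * u $ i"
  by (induction n) (simp_all add: algebra_simps)

definition diff1 :: "'a::ab_group_add \<Rightarrow> ('a \<Rightarrow> int) \<Rightarrow> 'a \<Rightarrow> int" where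
  "diff1 u f y = f y - f (y - u)"

primrec diffs :: "'a::ab_group_add list \<Rightarrow> ('a \<Rightarrow> int) \<Rightarrow> 'a \<Rightarrow> int" where
  "diffs [] f = f"
| "diffs (u # us) f = diffs us (diff1 u f)"

definition finsupp :: "('a \<Rightarrow> int) \<Rightarrow> bool" where
  "finsupp f \<longleftrightarrow> finite {y. f y \<noteq> 0}"

lemma diffs_append: "diffs (us @ ws) f = diffs ws (diffs us f)"
  by (induction us arbitrary: f) simp_all

lemma diff1_commute: "diff1 u (diff1 w f) = diff1 w (diff1 u f)"
  by (rule ext) (simp add: diff1_def algebra_simps)

lemma diffs_diff1: "diffs us (diff1 w f) = diff1 w (diffs us f)"
proof (induction us arbitrary: f)
  case (Cons u us)
  show ?case by (simp only: diffs.simps diff1_commute[of u w] Cons.IH)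
qed simp

lemma diffs_commute: "diffs us (diffs ws f) = diffs ws (diffs us f)"
  by (induction us arbitrary: f) (simp_all add: diffs_diff1)

lemma diffs_zero: "diffs us (\<lambda>_. 0) = (\<lambda>_. 0)"
proof (induction us)
  case (Cons u us)
  have "diff1 u (\<lambda>_. 0) = (\<lambda>_. 0)" by (rule ext) (simp add: diff1_def)
  with Cons show ?case by simp
qed simp

lemma diff1_minus: "diff1 u (\<lambda>y. f y - g y) = (\<lambda>y. diff1 u f y - diff1 u g y)"
  by (rule ext) (simp add: diff1_def)

lemma diffs_minus: "diffs us (\<lambda>y. f y - g y) = (\<lambda>y. diffs us f y - diffs us g y)"
  by (induction us arbitrary: f g) (simp_all add: diff1_minus)

lemma diff1_sum: "diff1 u (\<lambda>y. \<Sum>v\<in>W. f v y) = (\<lambda>y. \<Sum>v\<in>W. diff1 u (f v) y)"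
  by (rule ext) (simp add: diff1_def sum_subtractf)

lemma diffs_sum: "diffs us (\<lambda>y. \<Sum>v\<in>W. f v y) = (\<lambda>y. \<Sum>v\<in>W. diffs us (f v) y)"
  by (induction us arbitrary: f) (simp_all add: diff1_sum)

lemma diffs_shift: "diffs us (\<lambda>y. f (y - a)) = (\<lambda>y. diffs us f (y - a))"
proof (induction us arbitrary: f)
  case (Cons u us)
  have "diff1 u (\<lambda>y. f (y - a)) = (\<lambda>y. diff1 u f (y - a))"
    by (rule ext) (simp add: diff1_def algebra_simps)
  then show ?case by (simp add: Cons.IH)
qed simp

lemma finsupp_shift: "finsupp f \<Longrightarrow> finsupp (\<lambda>y. f (y - a :: 'a::ab_group_add))"
proof -
  assume "finsupp f"
  moreover have "{y. f (y - a) \<noteq> 0} = (\<lambda>y. y + a) ` {y. f y \<noteq> 0}"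
  proof (intro set_eqI iffI)
    fix y assume "y \<in> {y. f (y - a) \<noteq> 0}"
    then show "y \<in> (\<lambda>y. y + a) ` {y. f y \<noteq> 0}"
      by (intro image_eqI[of _ _ "y - a"]) auto
  qed auto
  ultimately show ?thesis by (simp add: finsupp_def)
qed

lemma finsupp_minus: "finsupp f \<Longrightarrow> finsupp g \<Longrightarrow> finsupp (\<lambda>y. f y - g y)"
  unfolding finsupp_def
  by (rule finite_subset[of _ "{y. f y \<noteq> 0} \<union> {y. g y \<noteq> 0}"]) auto

lemma finsupp_sum:
  assumes "finite W" "\<And>v. v \<in> W \<Longrightarrow> finsupp (f v)"
  shows "finsupp (\<lambda>y. \<Sum>v\<in>W. f v y)"
  unfolding finsupp_def
proof (rule finite_subset)
  show "{y. (\<Sum>v\<in>W. f v y) \<noteq> 0} \<subseteq> (\<Union>v\<in>W. {y. f v y \<noteq> 0})"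
    by (auto dest: sum.not_neutral_contains_not_neutral)
  show "finite (\<Union>v\<in>W. {y. f v y \<noteq> 0})"
    using assms by (auto simp: finsupp_def)
qed

lemma finsupp_diff1: "finsupp f \<Longrightarrow> finsupp (diff1 u f)"
  unfolding diff1_def[abs_def] by (intro finsupp_minus finsupp_shift)

lemma finsupp_diffs: "finsupp f \<Longrightarrow> finsupp (diffs us f)"
  by (induction us arbitrary: f) (simp_all add: finsupp_diff1)

section \<open>Finitely generated translation-closed sets\<close>

text \<open>The exponents occurring in a monomial module over a polynomial ring with one variable
  for each entry of \<open>us\<close>. The recursion splits off one generator, as the later
  inductions require.\<close>

primrec gspan :: "'a::ab_group_add list \<Rightarrow> 'a set \<Rightarrow> 'a set" where
  "gspan [] B = B"
| "gspan (u # us) B = {m + nmul j u | m j. m \<in> gspan us B}"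

lemma gspan_ConsI: "m \<in> gspan us B \<Longrightarrow> m + nmul j u \<in> gspan (u # us) B"
  by auto

lemma gspan_Cons_superset: "gspan us B \<subseteq> gspan (u # us) B"
proof
  fix m assume "m \<in> gspan us B"
  from gspan_ConsI[OF this, of 0 u] show "m \<in> gspan (u # us) B" by (simp del: gspan.simps)
qed

lemma gspan_subset: "B \<subseteq> gspan us B"
proof (induction us)
  case (Cons u us)
  then show ?case using gspan_Cons_superset by blast
qed simp

lemma gspan_mono: "B \<subseteq> C \<Longrightarrow> gspan us B \<subseteq> gspan us C"
  by (induction us) fastforce+

lemma gspan_closed: "m \<in> gspan us B \<Longrightarrow> u \<in> set us \<Longrightarrow> m + u \<in> gspan us B"
proof (induction us arbitrary: m)
  case (Cons w us)
  from Cons.prems(1) obtain m' j where m: "m = m' + nmul j w" "m' \<in> gspan us B" by auto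
  show ?case
  proof (cases "u = w")
    case True
    then have "m + u = m' + nmul (Suc j) w" by (simp add: m algebra_simps)
    then show ?thesis using gspan_ConsI[OF m(2)] by metis
  next
    case False
    with Cons.prems have "u \<in> set us" by auto
    with Cons.IH m have "m' + u \<in> gspan us B" by blast
    moreover have "m + u = (m' + u) + nmul j w" by (simp add: m algebra_simps)
    ultimately show ?thesis using gspan_ConsI by metis
  qed
qed simp

lemma nmul_closed:
  assumes "\<And>x. x \<in> N \<Longrightarrow> x + u \<in> N" "x \<in> N"
  shows "x + nmul j u \<in> N"
  using assms(2)
proof (induction j arbitrary: x)
  case (Suc j)
  have "(x + u) + nmul j u \<in> N" using Suc assms(1) by blast
  then show ?case by (simp add: algebra_simps)
qed simp

lemma gspan_least:
  "B \<subseteq> N \<Longrightarrow> (\<And>x u. x \<in> N \<Longrightarrow> u \<in> set us \<Longrightarrow> x + u \<in> N) \<Longrightarrow> gspan us B \<subseteq> N"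
proof (induction us)
  case (Cons w us)
  have "gspan us B \<subseteq> N" using Cons by simp
  moreover have "m + nmul j w \<in> N" if "m \<in> N" for m j
    using that Cons.prems(2) by (intro nmul_closed) auto
  ultimately show ?case by auto
qed simp

text \<open>Some subsequence is monotone; if it decreases, it is constant from the index of its
  minimum on.\<close>

lemma nat_mono_subseq: "\<exists>r :: nat \<Rightarrow> nat. strict_mono r \<and> (\<forall>i j. i \<le> j \<longrightarrow> s (r i) \<le> s (r j))"
  for s :: "nat \<Rightarrow> nat"
proof -
  obtain f where f: "strict_mono f" "monoseq (\<lambda>n. s (f n))"
    using seq_monosub[of s] by auto
  show ?thesis
  proof (cases "\<forall>m. \<forall>n\<ge>m. s (f m) \<le> s (f n)")
    case True
    with f(1) show ?thesis by (intro exI[of _ f]) auto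
  next
    case False
    with f have dec: "\<And>m n. m \<le> n \<Longrightarrow> s (f n) \<le> s (f m)"
      by (auto simp: monoseq_def)
    obtain n0 where n0: "\<And>n. s (f n0) \<le> s (f n)"
      using ex_has_least_nat[of "\<lambda>_. True" 0 "\<lambda>n. s (f n)"] by auto
    have "s (f (n0 + i)) = s (f n0)" for i
      using dec[of n0 "n0 + i"] n0[of "n0 + i"] by simp
    moreover have "strict_mono (\<lambda>i. f (n0 + i))"
      using f(1) by (auto simp: strict_mono_def)
    ultimately show ?thesis by (intro exI[of _ "\<lambda>i. f (n0 + i)"]) simp
  qed
qed

text \<open>Dickson's lemma: the order in which \<^term>\<open>y\<close> lies above \<^term>\<open>x\<close> if it belongs to the
  translation-closed set generated by \<^term>\<open>x\<close> is a well-quasi-order on a finitely generated set.\<close>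

lemma gspan_wqo:
  fixes s :: "nat \<Rightarrow> 'a::ab_group_add"
  assumes "finite B" "\<And>k. s k \<in> gspan us B"
  shows "\<exists>r :: nat \<Rightarrow> nat. strict_mono r \<and> (\<forall>i j. i \<le> j \<longrightarrow> s (r j) \<in> gspan us {s (r i)})"
  using assms(2)
proof (induction us arbitrary: s)
  case Nil
  then have "range s \<subseteq> B" by auto
  with assms(1) have "finite (range s)" by (rule rev_finite_subset)
  then obtain b where "infinite {n. s n = b}"
    using pigeonhole_infinite[OF infinite_UNIV_nat] by force
  then obtain r :: "nat \<Rightarrow> nat" where "strict_mono r" "\<And>n. r n \<in> {n. s n = b}"
    using infinite_enumerate by blast
  then show ?case by (intro exI[of _ r]) simp
next
  case (Cons u us)
  have "\<exists>m j. m \<in> gspan us B \<and> s k = m + nmul j u" for k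
    using Cons.prems[of k] by auto
  then obtain m j where mj: "\<And>k. m k \<in> gspan us B" "\<And>k. s k = m k + nmul (j k) u" by metis
  obtain r :: "nat \<Rightarrow> nat" where r: "strict_mono r" "\<And>a b. a \<le> b \<Longrightarrow> m (r b) \<in> gspan us {m (r a)}"
    using Cons.IH[of m] mj(1) by blast
  \<comment> \<open>The multiplicities of \<open>u\<close> are put in order after the remaining
    parts, since passing to a further subsequence preserves the order of the latter.\<close>
  obtain q :: "nat \<Rightarrow> nat" where q: "strict_mono q" "\<And>a b. a \<le> b \<Longrightarrow> j (r (q a)) \<le> j (r (q b))"
    using nat_mono_subseq[of "\<lambda>n. j (r n)"] by blast
  have shift: "m' + c \<in> gspan us {x + c}" if "m' \<in> gspan us {x}" for m' x c
  proof -
    have "gspan us {x} \<subseteq> {z. z + c \<in> gspan us {x + c}}"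
    proof (rule gspan_least)
      show "{x} \<subseteq> {z. z + c \<in> gspan us {x + c}}"
        using gspan_subset by auto
      fix z w assume "z \<in> {z. z + c \<in> gspan us {x + c}}" "w \<in> set us"
      then have "(z + c) + w \<in> gspan us {x + c}"
        by (auto intro: gspan_closed[of "z + c"])
      then show "z + w \<in> {z. z + c \<in> gspan us {x + c}}" by (simp add: algebra_simps)
    qed
    with that show ?thesis by auto
  qed
  have "s (r (q b)) \<in> gspan (u # us) {s (r (q a))}" if "a \<le> b" for a b
  proof -
    from q that obtain d where d: "j (r (q b)) = j (r (q a)) + d"
      using le_Suc_ex by blast
    have "q a \<le> q b" using q(1) that by (simp add: strict_mono_less_eq)
    from shift[OF r(2)[OF this]]
    have "m (r (q b)) + nmul (j (r (q a))) u \<in> gspan us {s (r (q a))}"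
      by (simp add: mj(2))
    moreover have "s (r (q b)) = (m (r (q b)) + nmul (j (r (q a))) u) + nmul d u"
      by (simp add: mj(2) d nmul_add algebra_simps)
    ultimately show ?thesis using gspan_ConsI by metis
  qed
  moreover have "strict_mono (\<lambda>n. r (q n))"
    using r(1) q(1) by (simp add: strict_mono_def)
  ultimately show ?case by blast
qed

text \<open>Otherwise elements of \<open>N\<close> can be picked forever, each outside the set
  generated by its predecessors, while the well-quasi-order places some later pick in the set
  generated by an earlier one.\<close>

lemma gspan_noetherian:
  assumes "finite B" "N \<subseteq> gspan us B" "\<And>x u. x \<in> N \<Longrightarrow> u \<in> set us \<Longrightarrow> x + u \<in> N"
  shows "\<exists>F. finite F \<and> N = gspan us F"
proof (rule ccontr)
  assume contra: "\<nexists>F. finite F \<and> N = gspan us F"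
  have "\<exists>x. x \<in> N \<and> x \<notin> gspan us F" if "finite F" "F \<subseteq> N" for F
    using contra gspan_least[OF that(2) assms(3)] that(1) by blast
  then obtain c where c: "\<And>F. finite F \<Longrightarrow> F \<subseteq> N \<Longrightarrow> c F \<in> N \<and> c F \<notin> gspan us F"
    by metis
  \<comment> \<open>\<open>L n\<close> lists the first \<open>n\<close> picks, since each new pick
    depends on all the earlier ones.\<close>
  define L where "L = rec_nat [] (\<lambda>_ xs. c (set xs) # xs)"
  have L: "L 0 = []" "\<And>n. L (Suc n) = c (set (L n)) # L n"
    by (simp_all add: L_def)
  define s where "s n = c (set (L n))" for n
  have LN: "set (L n) \<subseteq> N" for n
    by (induction n) (use c L in auto)
  have s: "s n \<in> N" "s n \<notin> gspan us (set (L n))" for n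
    using c[OF _ LN[of n]] by (auto simp: s_def)
  have sL: "i < n \<Longrightarrow> s i \<in> set (L n)" for i n
    by (induction n) (auto simp: L s_def less_Suc_eq)
  obtain r :: "nat \<Rightarrow> nat" where r: "strict_mono r" "\<And>i j. i \<le> j \<Longrightarrow> s (r j) \<in> gspan us {s (r i)}"
    using gspan_wqo[OF assms(1), of s us] s(1) assms(2) by blast
  have "r 0 < r 1" using r(1) by (simp add: strict_mono_def)
  then have "gspan us {s (r 0)} \<subseteq> gspan us (set (L (r 1)))"
    by (intro gspan_mono) (use sL in auto)
  with r(2)[of 0 1] s(2)[of "r 1"] show False by auto
qed

text \<open>A combinatorial form of the Hilbert--Serre theorem. If \<open>M'\<close> is generated without using \<open>u\<close>, the
  difference in direction \<open>u\<close> of the indicator of \<open>M\<close> is the indicator of \<open>M'\<close> minus that of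
  \<open>M' \<inter> (M + u)\<close>, and the latter set is finitely generated again.\<close>

lemma finsupp_diffs_gspan:
  assumes "finite B"
  shows "finsupp (diffs us (\<lambda>y. of_bool (y \<in> gspan us B)))"
  using assms
proof (induction us arbitrary: B)
  case Nil
  then show ?case by (simp add: finsupp_def)
next
  case (Cons u us)
  let ?M = "gspan (u # us) B" and ?M' = "gspan us B"
  define N where "N = {y \<in> ?M'. y - u \<in> ?M}"
  have cl: "x + w \<in> N" if "x \<in> N" "w \<in> set us" for x w
  proof -
    have "x + w \<in> ?M'" using that gspan_closed by (auto simp: N_def simp del: gspan.simps)
    moreover have "x - u + w \<in> ?M"
      using that gspan_closed[of "x - u" "u # us" B w] by (auto simp: N_def simp del: gspan.simps)
    ultimately show ?thesis by (simp add: N_def algebra_simps del: gspan.simps)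
  qed
  obtain F where F: "finite F" "N = gspan us F"
    using gspan_noetherian[OF Cons.prems, of N us] cl by (auto simp: N_def simp del: gspan.simps)
  have M: "y \<in> ?M \<longleftrightarrow> y \<in> ?M' \<or> y - u \<in> ?M" for y
  proof
    assume "y \<in> ?M"
    then obtain m j where mj: "y = m + nmul j u" "m \<in> ?M'" by auto
    show "y \<in> ?M' \<or> y - u \<in> ?M"
    proof (cases j)
      case (Suc i)
      then have "y - u = m + nmul i u" by (simp add: mj(1) algebra_simps)
      then show ?thesis using gspan_ConsI[OF mj(2)] by metis
    qed (use mj in simp)
  next
    assume "y \<in> ?M' \<or> y - u \<in> ?M"
    moreover have "?M' \<subseteq> ?M" by (rule gspan_Cons_superset)
    moreover have "y - u \<in> ?M \<Longrightarrow> (y - u) + u \<in> ?M" by (rule gspan_closed) auto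
    ultimately show "y \<in> ?M" by (auto simp del: gspan.simps)
  qed
  have "diff1 u (\<lambda>y. of_bool (y \<in> ?M)) = (\<lambda>y. of_bool (y \<in> ?M') - of_bool (y \<in> gspan us F))"
  proof
    fix y
    show "diff1 u (\<lambda>y. of_bool (y \<in> ?M)) y = of_bool (y \<in> ?M') - of_bool (y \<in> gspan us F)"
      using M[of y] F(2) by (auto simp: diff1_def N_def simp del: gspan.simps)
  qed
  then have "diffs (u # us) (\<lambda>y. of_bool (y \<in> ?M))
      = (\<lambda>y. diffs us (\<lambda>y. of_bool (y \<in> ?M')) y - diffs us (\<lambda>y. of_bool (y \<in> gspan us F)) y)"
    by (simp add: diffs_minus del: gspan.simps)
  then show ?case
    using Cons.IH[OF Cons.prems] Cons.IH[OF F(1)] by (simp add: finsupp_minus del: gspan.simps)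
qed

section \<open>Averages and differences along a dilation\<close>

lemma nmul_diff: "nmul n (x - y) = nmul n x - nmul n y"
  by (induction n) (simp_all add: algebra_simps)

text \<open>Multiplication of the generating function by \<open>1 + x^u + ... + x^((N-1)u)\<close>
  for each \<open>u\<close> in the list, that is by the quotient of \<open>1 - x^(N u)\<close> by
  \<open>1 - x^u\<close>.\<close>

primrec avg :: "nat \<Rightarrow> 'a::ab_group_add list \<Rightarrow> ('a \<Rightarrow> int) \<Rightarrow> 'a \<Rightarrow> int" where
  "avg N [] f = f"
| "avg N (u # us) f = avg N us (\<lambda>y. \<Sum>j<N. f (y - nmul j u))"

lemma avg_zero: "avg N us (\<lambda>_. 0) = (\<lambda>_. 0)"
  by (induction us) simp_all

lemma diff1_nmul: "diff1 (nmul N u) f = (\<lambda>y. \<Sum>j<N. diff1 u f (y - nmul j u))"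
proof
  fix y
  show "diff1 (nmul N u) f y = (\<Sum>j<N. diff1 u f (y - nmul j u))"
    by (induction N) (simp_all add: diff1_def algebra_simps)
qed

lemma diffs_nmul: "diffs (map (nmul N) us) f = avg N us (diffs us f)"
proof (induction us arbitrary: f)
  case (Cons u us)
  have "diffs us (\<lambda>y. \<Sum>j<N. diff1 u f (y - nmul j u))
      = (\<lambda>y. \<Sum>j<N. diffs us (diff1 u f) (y - nmul j u))"
    by (simp only: diffs_sum diffs_shift)
  then show ?case by (simp add: Cons.IH diff1_nmul)
qed simp

text \<open>Each factor translates the support by at most \<open>N - 1\<close> copies of
  \<open>u\<close>, which lowers \<open>lam\<close> by at most \<open>N - 1\<close> times the
  negative part of \<open>lam u\<close>.\<close>

lemma avg_support:
  fixes lam :: "'a::ab_group_add \<Rightarrow> int"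
  assumes lam: "\<And>x y. lam (x - y) = lam x - lam y" "\<And>n x. lam (nmul n x) = int n * lam x"
    and "0 < N" "\<And>x. f x \<noteq> 0 \<Longrightarrow> K \<le> lam x" "avg N us f x \<noteq> 0"
  shows "K + (int N - 1) * (\<Sum>u\<leftarrow>us. min 0 (lam u)) \<le> lam x"
  using assms(4,5)
proof (induction us arbitrary: f K)
  case (Cons u us)
  let ?g = "\<lambda>y. \<Sum>j<N. f (y - nmul j u)"
  have "K + (int N - 1) * min 0 (lam u) \<le> lam y" if "?g y \<noteq> 0" for y
  proof -
    have "\<exists>j<N. f (y - nmul j u) \<noteq> 0"
    proof (rule ccontr)
      assume "\<not> (\<exists>j<N. f (y - nmul j u) \<noteq> 0)"
      then have "(\<Sum>j<N. f (y - nmul j u)) = 0" by (intro sum.neutral) simp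
      with that show False by simp
    qed
    then obtain j where j: "j < N" "f (y - nmul j u) \<noteq> 0" by blast
    have "K \<le> lam y - int j * lam u"
      using Cons.prems(1)[OF j(2)] by (simp add: lam)
    moreover have "(int N - 1) * min 0 (lam u) \<le> int j * min 0 (lam u)"
      using j(1) by (intro mult_right_mono_neg) auto
    moreover have "int j * min 0 (lam u) \<le> int j * lam u"
      by (intro mult_left_mono) auto
    ultimately show ?thesis by linarith
  qed
  from Cons.IH[OF this] Cons.prems(2) show ?case by (simp add: algebra_simps)
qed simp

text \<open>Pulling back along \<open>y\<close> to \<open>h y + a\<close> turns a difference by
  \<open>h u\<close> into one by \<open>u\<close>. With \<open>h\<close> a dilation this compares a
  function with its restriction to a coset of a sublattice.\<close>

lemma diffs_affine:
  assumes "\<And>x y. h (x - y) = h x - h y"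
  shows "diffs (map h us) f (h y + a) = diffs us (\<lambda>z. f (h z + a)) y"
proof (induction us arbitrary: f)
  case (Cons u us)
  have "(\<lambda>z. diff1 (h u) f (h z + a)) = diff1 u (\<lambda>z. f (h z + a))"
    by (rule ext) (simp add: diff1_def assms algebra_simps)
  then show ?case by (simp add: Cons.IH)
qed simp

text \<open>The differences at one point involve only finitely many values, so pointwise
  stabilisation passes to them.\<close>

lemma diffs_eventually:
  assumes "\<And>z. eventually (\<lambda>k. f k z = g z) sequentially"
  shows "eventually (\<lambda>k. diffs us (f k) y = diffs us g y) sequentially"
  using assms
proof (induction us arbitrary: f g)
  case (Cons u us)
  have "eventually (\<lambda>k. diff1 u (f k) z = diff1 u g z) sequentially" for z
    using Cons.prems[of z] Cons.prems[of "z - u"]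
    by eventually_elim (simp add: diff1_def)
  from Cons.IH[OF this] show ?case by simp
qed simp

text \<open>A function invariant under translation by \<open>u\<close> is constant along the
  infinite set of points \<open>y - n u\<close>, so a nonzero value contradicts finite
  support.\<close>

lemma finsupp_diff1_zero:
  fixes f :: "int ^ 'd \<Rightarrow> int"
  assumes "finsupp f" "diff1 u f = (\<lambda>_. 0)" "u \<noteq> 0"
  shows "f = (\<lambda>_. 0)"
proof (rule ccontr)
  assume "f \<noteq> (\<lambda>_. 0)"
  then obtain y where y: "f y \<noteq> 0" by auto
  have step: "f z = f (z - u)" for z
    using fun_cong[OF assms(2), of z] by (simp add: diff1_def)
  have "f (y - nmul n u) = f y" for n
    by (induction n) (simp_all add: step[of "y - nmul _ u"] algebra_simps)
  then have "range (\<lambda>n. y - nmul n u) \<subseteq> {y. f y \<noteq> 0}" using y by auto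
  moreover have "inj (\<lambda>n. y - nmul n u)"
  proof (rule injI)
    fix m n assume "y - nmul m u = y - nmul n u"
    then have eq: "nmul m u = nmul n u" by simp
    obtain i where "u $ i \<noteq> 0" using assms(3) by (auto simp: vec_eq_iff)
    moreover have "int m * u $ i = int n * u $ i"
      using arg_cong[OF eq, of "\<lambda>x. x $ i"] by (simp add: nmul_component)
    ultimately show "m = n" by simp
  qed
  ultimately show False
    using assms(1) by (metis finsupp_def finite_subset finite_imageD infinite_UNIV_nat)
qed

lemma finsupp_diffs_zero:
  fixes f :: "int ^ 'd \<Rightarrow> int"
  assumes "finsupp f" "diffs us f = (\<lambda>_. 0)" "0 \<notin> set us"
  shows "f = (\<lambda>_. 0)"
  using assms
proof (induction us arbitrary: f)
  case (Cons u us)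
  then have "diff1 u f = (\<lambda>_. 0)" 
    using Cons.IH[of "diff1 u f"] by (simp add: finsupp_diff1)
  with Cons.prems show ?case using finsupp_diff1_zero[of f u] by simp
qed simp

lemma diffs_remove1: "u \<in> set us \<Longrightarrow> diffs us f = diff1 u (diffs (remove1 u us) f)"
proof (induction us arbitrary: f)
  case (Cons w us)
  then show ?case
    by (cases "u = w") (simp_all add: diffs_diff1 diff1_commute[of w u])
qed simp

section \<open>Linear recurrences whose characteristic roots are translations\<close>

primrec recur :: "'a::ab_group_add list \<Rightarrow> (nat \<Rightarrow> 'a \<Rightarrow> int) \<Rightarrow> nat \<Rightarrow> 'a \<Rightarrow> int" where
  "recur [] f = f"
| "recur (v # vs) f = recur vs (\<lambda>k y. f (Suc k) y - f k (y - v))"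

text \<open>A sequence of functions annihilated by \<open>\<Prod>\<^sub>v (E - T\<^sub>v)\<close>, where \<open>E\<close> shifts the index and
  \<open>T\<^sub>v\<close> translates by \<open>v\<close>, is a combination of the \<open>T\<^sub>v\<^sup>k\<close> after multiplication by the Vandermonde
  factors \<open>T\<^sub>v - T\<^sub>w\<close>.\<close>

lemma recur_solution:
  assumes "distinct vs" "\<And>k. finsupp (f k)" "recur vs f = (\<lambda>k y. 0)"
  shows "\<exists>ws g. 0 \<notin> set ws \<and> (\<forall>v\<in>set vs. finsupp (g v)) \<and>
           (\<forall>k y. diffs ws (f k) y = (\<Sum>v\<in>set vs. g v (y - nmul k v)))"
  using assms
proof (induction vs arbitrary: f)
  case Nil
  then have "f k y = 0" for k y by (metis recur.simps(1))
  then show ?case by (intro exI[of _ "[]"]) auto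
next
  case (Cons v1 vs)
  define f' where "f' = (\<lambda>k y. f (Suc k) y - f k (y - v1))"
  have finf': "finsupp (f' k)" for k
    unfolding f'_def by (intro finsupp_minus finsupp_shift Cons.prems(2))
  have "distinct vs" "recur vs f' = (\<lambda>k y. 0)" using Cons.prems by (simp_all add: f'_def)
  from Cons.IH[OF this(1) finf' this(2)] obtain ws g where ws: "0 \<notin> set ws" and g: "\<And>v. v \<in> set vs \<Longrightarrow> finsupp (g v)"
    and f': "\<And>k y. diffs ws (f' k) y = (\<Sum>v\<in>set vs. g v (y - nmul k v))"
    by blast
  \<comment> \<open>These are, up to translation, the Vandermonde factors between the new root
    \<open>v1\<close> and the others.\<close>
  define ds where "ds = map (\<lambda>v. v - v1) vs"
  define X where "X v = diffs (remove1 (v - v1) ds) (g v)" for v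
  \<comment> \<open>\<open>G v\<close> solves \<open>(T_v - T_v1) G = diffs ds (g v)\<close>: the
    factor for \<open>v\<close> is omitted from \<open>ds\<close> in \<open>X v\<close>, and the
    sign and the shift come from \<open>T_v - T_v1 = - T_v1 (1 - T_(v - v1))\<close>.\<close>
  define G where "G v y = - X v (y + v1)" for v y
  \<comment> \<open>Subtracting this particular solution leaves a solution of the homogeneous
    equation for \<open>v1\<close>, whose value at \<open>k\<close> is its initial value translated
    by \<open>k\<close> copies of \<open>v1\<close>.\<close>
  define h where "h k y = diffs (ws @ ds) (f k) y - (\<Sum>v\<in>set vs. G v (y - nmul k v))" for k y
  have G: "G v (y - v) - G v (y - v1) = diffs ds (g v) y" if "v \<in> set vs" for v y
  proof -
    have "v - v1 \<in> set ds" using that by (auto simp: ds_def)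
    then have "diffs ds (g v) y = X v y - X v (y - (v - v1))"
      by (subst diffs_remove1) (auto simp: X_def diff1_def)
    then show ?thesis by (simp add: G_def algebra_simps)
  qed
  have finG: "finsupp (G v)" if "v \<in> set vs" for v
  proof -
    have "finsupp (X v)" using g[OF that] by (simp add: X_def finsupp_diffs)
    then have "finsupp (\<lambda>y. X v (y - (- v1)))" by (rule finsupp_shift)
    then show ?thesis by (simp add: finsupp_def G_def)
  qed
  have "h (Suc k) y - h k (y - v1) = 0" for k y
  proof -
    have "diffs (ws @ ds) (f' k) y = diffs (ws @ ds) (f (Suc k)) y - diffs (ws @ ds) (f k) (y - v1)"
      by (simp only: f'_def diffs_minus diffs_shift)
    moreover have "diffs (ws @ ds) (f' k) y = (\<Sum>v\<in>set vs. diffs ds (g v) (y - nmul k v))"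
    proof -
      have "diffs ws (f' k) = (\<lambda>y. \<Sum>v\<in>set vs. g v (y - nmul k v))"
        using f' by auto
      then show ?thesis by (simp only: diffs_append diffs_sum diffs_shift)
    qed
    moreover have "\<dots> = (\<Sum>v\<in>set vs. G v (y - nmul (Suc k) v) - G v (y - v1 - nmul k v))"
      using G by (intro sum.cong) (auto simp: algebra_simps simp flip: G)
    ultimately show ?thesis by (simp add: h_def sum_subtractf)
  qed
  then have h: "h k y = h 0 (y - nmul k v1)" for k y
    by (induction k arbitrary: y) (auto simp: algebra_simps)
  have "finsupp (diffs (ws @ ds) (f 0))" by (simp add: finsupp_diffs Cons.prems(2))
  then have finh: "finsupp (h 0)"
    unfolding h_def[abs_def] using finG
    by (intro finsupp_minus finsupp_sum finsupp_shift) auto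
  define G' where "G' v = (if v = v1 then h 0 else G v)" for v
  have "diffs (ws @ ds) (f k) y = (\<Sum>v\<in>set (v1 # vs). G' v (y - nmul k v))" for k y
  proof -
    have "(\<Sum>v\<in>set (v1 # vs). G' v (y - nmul k v))
        = h 0 (y - nmul k v1) + (\<Sum>v\<in>set vs. G v (y - nmul k v))"
      using Cons.prems(1) by (auto simp: G'_def intro: sum.cong)
    moreover have "diffs (ws @ ds) (f k) y = h k y + (\<Sum>v\<in>set vs. G v (y - nmul k v))"
      by (simp add: h_def)
    ultimately show ?thesis using h[of k y] by simp
  qed
  moreover have "0 \<notin> set (ws @ ds)" using ws Cons.prems(1) by (auto simp: ds_def)
  moreover have "\<forall>v\<in>set (v1 # vs). finsupp (G' v)" using finG finh by (auto simp: G'_def)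
  ultimately show ?case by blast
qed

text \<open>For slices of a function on the product, \<open>E - T_v\<close> is the difference in
  direction \<open>(v, p)\<close> read one index later; the summand \<open>int (length vs)\<close>
  counts these shifts. This turns the Hilbert--Serre theorem into a recurrence.\<close>

lemma recur_eq_diffs:
  fixes F :: "'a::ab_group_add \<times> int \<Rightarrow> int"
  shows "recur vs (\<lambda>k y. F (y, int k * p + c)) k y
       = diffs (map (\<lambda>v. (v, p)) vs) F (y, (int k + int (length vs)) * p + c)"
proof (induction vs arbitrary: F c)
  case (Cons v vs)
  have "(\<lambda>k y. F (y, int (Suc k) * p + c) - F (y - v, int k * p + c))
      = (\<lambda>k y. diff1 (v, p) F (y, int k * p + (p + c)))"
    by (intro ext) (simp add: diff1_def algebra_simps)
  then show ?case using Cons.IH[of "diff1 (v, p) F" "p + c"]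
    by (simp add: algebra_simps)
qed simp

text \<open>Gordan's lemma: a lattice point of the cone is an element of the half-open fundamental
  parallelepiped plus a nonnegative integer combination of the generators.\<close>

lemma lattice_cone_gspan:
  fixes \<rho> :: "'a::ab_group_add \<Rightarrow> 'b::real_normed_vector"
  assumes add: "\<And>x y. \<rho> (x + y) = \<rho> x + \<rho> y" and fin: "\<And>R. finite {y. norm (\<rho> y) \<le> R}"
    and dist: "distinct us"
  shows "\<exists>B. finite B \<and>
    {z. \<exists>c. (\<forall>u. 0 \<le> c u) \<and> \<rho> z = (\<Sum>u\<in>set us. c u *\<^sub>R \<rho> u)} = gspan us B"
proof -
  let ?M = "{z. \<exists>c. (\<forall>u. 0 \<le> c u) \<and> \<rho> z = (\<Sum>u\<in>set us. c u *\<^sub>R \<rho> u)}"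
  \<comment> \<open>The ball contains the parallelepiped, so \<open>B\<close> may be larger than the
    set of its lattice points, but it is finite and lies in the cone.\<close>
  define B where "B = {z \<in> ?M. norm (\<rho> z) \<le> (\<Sum>u\<in>set us. norm (\<rho> u))}"
  have "finite B" by (rule finite_subset[OF _ fin]) (auto simp: B_def)
  have gs: "b + (\<Sum>u\<in>set vs. nmul (n u) u) \<in> gspan vs B" if "b \<in> B" "distinct vs" for b n vs
    using that(2)
  proof (induction vs)
    case (Cons v vs)
    then have "b + (\<Sum>u\<in>set (v # vs). nmul (n u) u) = b + (\<Sum>u\<in>set vs. nmul (n u) u) + nmul (n v) v"
      by (simp add: algebra_simps)
    moreover have "b + (\<Sum>u\<in>set vs. nmul (n u) u) \<in> gspan vs B" using Cons by simp
    ultimately show ?case using gspan_ConsI by metis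
  qed (use that in simp)
  have \<rho>sum: "\<rho> (\<Sum>u\<in>A. nmul (n u) u) = (\<Sum>u\<in>A. real (n u) *\<^sub>R \<rho> u)" if "finite A" for A n
    using that
  proof (induction A rule: finite_induct)
    case empty
    have "\<rho> 0 + \<rho> 0 = \<rho> 0 + 0" by (metis add add.right_neutral)
    then show ?case by simp
  qed (simp add: add nmul_additive[of \<rho>, OF add])
  have "z \<in> gspan us B" if "z \<in> ?M" for z
  proof -
    from that obtain c where c: "\<And>u. 0 \<le> c u" "\<rho> z = (\<Sum>u\<in>set us. c u *\<^sub>R \<rho> u)" by auto
    define n where "n u = nat \<lfloor>c u\<rfloor>" for u
    have n: "real (n u) \<le> c u" "c u - real (n u) \<le> 1" for u
      using c(1)[of u] by (auto simp: n_def) linarith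
    define b where "b = z - (\<Sum>u\<in>set us. nmul (n u) u)"
    have z: "z = b + (\<Sum>u\<in>set us. nmul (n u) u)" by (simp add: b_def)
    have "\<rho> z = \<rho> b + (\<Sum>u\<in>set us. real (n u) *\<^sub>R \<rho> u)"
      by (subst z) (simp add: add \<rho>sum)
    then have b: "\<rho> b = (\<Sum>u\<in>set us. (c u - real (n u)) *\<^sub>R \<rho> u)"
      using c(2) by (simp add: scaleR_diff_left sum_subtractf)
    have "norm (\<rho> b) \<le> (\<Sum>u\<in>set us. norm (\<rho> u))"
      unfolding b
    proof (rule sum_norm_le)
      fix u
      have "\<bar>c u - real (n u)\<bar> * norm (\<rho> u) \<le> 1 * norm (\<rho> u)"
        using n[of u] by (intro mult_right_mono) auto
      then show "norm ((c u - real (n u)) *\<^sub>R \<rho> u) \<le> norm (\<rho> u)" by simp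
    qed
    moreover have "b \<in> ?M" using b n(1) by (auto intro!: exI[of _ "\<lambda>u. c u - real (n u)"])
    ultimately have "b \<in> B" by (simp add: B_def)
    from gs[OF this dist] show ?thesis using z by metis
  qed
  moreover have "gspan us B \<subseteq> ?M"
  proof (rule gspan_least)
    fix x u assume "x \<in> ?M" and u: "u \<in> set us"
    then obtain c where c: "\<And>u. 0 \<le> c u" "\<rho> x = (\<Sum>u\<in>set us. c u *\<^sub>R \<rho> u)" by auto
    have "\<rho> (x + u) = (\<Sum>w\<in>set us. (c w + of_bool (w = u)) *\<^sub>R \<rho> w)"
    proof -
      have "(\<Sum>w\<in>set us. of_bool (w = u) *\<^sub>R \<rho> w) = (\<Sum>w\<in>set us. if w = u then \<rho> w else 0)"
        by (intro sum.cong) auto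
      then show ?thesis using u by (simp add: add c(2) scaleR_left_distrib sum.distrib)
    qed
    then show "x + u \<in> ?M" using c(1) by (auto intro!: exI[of _ "\<lambda>w. c w + of_bool (w = u)"])
  qed (auto simp: B_def)
  ultimately show ?thesis using \<open>finite B\<close> by blast
qed

section \<open>Tangent cones of polytopes\<close>

lemma convex_cone_hull_finite:
  assumes "finite S"
  shows "convex_cone hull S = {x. \<exists>c. (\<forall>s. 0 \<le> c s) \<and> x = (\<Sum>s\<in>S. c s *\<^sub>R s)}"
    (is "_ = ?R")
proof
  show "convex_cone hull S \<subseteq> ?R"
  proof (rule hull_minimal)
    show "S \<subseteq> ?R"
    proof
      fix s assume s: "s \<in> S"
      have "s = (\<Sum>t\<in>S. (if t = s then 1 else 0) *\<^sub>R t)"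
        using s assms by (simp add: if_distrib if_distribR sum.delta' cong: if_cong)
      then show "s \<in> ?R" by (intro CollectI exI[of _ "\<lambda>t. if t = s then 1 else 0"]) simp
    qed
    show "convex_cone ?R"
      unfolding convex_cone_iff
    proof (intro conjI ballI allI impI)
      show "0 \<in> ?R" by (intro CollectI exI[of _ "\<lambda>_. 0"]) simp
    next
      fix x y assume "x \<in> ?R" "y \<in> ?R"
      then obtain c d where "\<forall>s. 0 \<le> c s" "x = (\<Sum>s\<in>S. c s *\<^sub>R s)"
        "\<forall>s. 0 \<le> d s" "y = (\<Sum>s\<in>S. d s *\<^sub>R s)" by auto
      then show "x + y \<in> ?R"
        by (intro CollectI exI[of _ "\<lambda>s. c s + d s"]) (simp add: scaleR_left_distrib sum.distrib)
    next
      fix x and r :: real assume "x \<in> ?R" "0 \<le> r"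
      moreover from this obtain c where "\<forall>s. 0 \<le> c s" "x = (\<Sum>s\<in>S. c s *\<^sub>R s)" by auto
      ultimately show "r *\<^sub>R x \<in> ?R"
        by (intro CollectI exI[of _ "\<lambda>s. r * c s"]) (simp add: scaleR_sum_right)
    qed
  qed
  have "(\<Sum>s\<in>T. c s *\<^sub>R s) \<in> convex_cone hull S" if "T \<subseteq> S" "\<forall>s. 0 \<le> c s" for c T
    using finite_subset[OF that(1) assms] that(1)
  proof (induction T rule: finite_induct)
    case empty
    then show ?case by (simp add: convex_cone_hull_contains_0)
  next
    case (insert s T)
    have "c s *\<^sub>R s \<in> convex_cone hull S"
      using insert.prems that(2) by (intro convex_cone_hull_mul hull_inc) auto
    then show ?case
      using insert convex_cone_hull_add[of "c s *\<^sub>R s"] by auto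
  qed
  then show "?R \<subseteq> convex_cone hull S" by auto
qed

lemma convex_cone_hull_translate:
  assumes "v \<in> W"
  shows "convex_cone hull ((\<lambda>w. w - v) ` W) = {s *\<^sub>R (a - v) | s a. 0 \<le> s \<and> a \<in> convex hull W}"
proof -
  have "convex hull ((\<lambda>w. w - v) ` W) = (\<lambda>a. a - v) ` (convex hull W)"
    using convex_hull_translation[of "- v" W] by simp
  moreover have "(\<lambda>w. w - v) ` W \<noteq> {}" using assms by auto
  ultimately show ?thesis
    by (subst convex_cone_hull_convex_hull_nonempty) auto
qed

text \<open>A line in the tangent cone would yield points \<open>a\<close> and \<open>b\<close> of
  \<open>P\<close> on opposite sides of \<open>v\<close>, placing the extreme point \<open>v\<close>
  in an open segment.\<close>

lemma pointed_tangent_cone: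
  assumes "v extreme_point_of P" "P = convex hull W" "v \<in> W"
    and "x \<in> convex_cone hull ((\<lambda>w. w - v) ` W)" "- x \<in> convex_cone hull ((\<lambda>w. w - v) ` W)"
  shows "x = 0"
proof (rule ccontr)
  assume "x \<noteq> 0"
  obtain s a where sa: "x = s *\<^sub>R (a - v)" "0 \<le> s" "a \<in> P"
    using assms(2,4) convex_cone_hull_translate[OF assms(3)] by auto
  obtain t b where tb: "- x = t *\<^sub>R (b - v)" "0 \<le> t" "b \<in> P"
    using assms(2,5) convex_cone_hull_translate[OF assms(3)] by auto
  have pos: "s > 0" "t > 0" using sa tb \<open>x \<noteq> 0\<close> by (auto simp: less_le)
  have sum0: "s *\<^sub>R (a - v) + t *\<^sub>R (b - v) = 0" using sa(1) tb(1) by (metis add.right_inverse)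
  have "a \<noteq> b"
  proof
    assume "a = b"
    then have "(s + t) *\<^sub>R (a - v) = 0" using sum0 by (simp add: scaleR_left_distrib)
    then show False using pos sa \<open>x \<noteq> 0\<close> by auto
  qed
  have "(s + t) *\<^sub>R v = s *\<^sub>R a + t *\<^sub>R b"
    using sum0 by (simp add: algebra_simps)
  then have "v = (1 / (s + t)) *\<^sub>R (s *\<^sub>R a + t *\<^sub>R b)"
    using pos by (metis add_pos_pos divide_self_if less_irrefl mult.commute scaleR_one scaleR_scaleR
        times_divide_eq_right mult.right_neutral)
  also have "\<dots> = (1 - t / (s + t)) *\<^sub>R a + (t / (s + t)) *\<^sub>R b"
    using pos by (simp add: scaleR_right_distrib field_simps)
  finally have "v = (1 - t / (s + t)) *\<^sub>R a + (t / (s + t)) *\<^sub>R b" .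
  moreover have "0 < t / (s + t)" "t / (s + t) < 1" using pos by auto
  ultimately have "v \<in> open_segment a b" using \<open>a \<noteq> b\<close> by (auto simp: in_segment)
  with assms(1) sa(3) tb(3) show False by (auto simp: extreme_point_of_def)
qed

text \<open>An irredundant generator of a pointed cone spans an extreme ray. Moving its coefficients
  to the right shows that the remaining parts \<open>x'\<close> and \<open>y'\<close> add up to a
  multiple of \<open>a\<close>. A positive multiple contradicts irredundance; otherwise pointedness
  makes first the sum and then both parts zero.\<close>

lemma tangent_cone_irredundant_ray:
  fixes a :: "'a::real_vector"
  assumes "finite A" "a \<in> A" "a \<notin> convex_cone hull (A - {a})"
    and pointed: "\<And>x. x \<in> convex_cone hull A \<Longrightarrow> - x \<in> convex_cone hull A \<Longrightarrow> x = 0"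
    and "x \<in> convex_cone hull A" "y \<in> convex_cone hull A" "x + y = s *\<^sub>R a"
  shows "\<exists>r\<ge>0. x = r *\<^sub>R a"
proof -
  obtain c where c: "\<And>g. 0 \<le> c g" "x = (\<Sum>g\<in>A. c g *\<^sub>R g)"
    using assms(5) convex_cone_hull_finite[OF assms(1)] by auto
  obtain d where d: "\<And>g. 0 \<le> d g" "y = (\<Sum>g\<in>A. d g *\<^sub>R g)"
    using assms(6) convex_cone_hull_finite[OF assms(1)] by auto
  define x' y' where "x' = (\<Sum>g\<in>A-{a}. c g *\<^sub>R g)" and "y' = (\<Sum>g\<in>A-{a}. d g *\<^sub>R g)"
  have xy: "x = c a *\<^sub>R a + x'" "y = d a *\<^sub>R a + y'"
    unfolding c(2) d(2) x'_def y'_def using assms(1,2) by (auto simp: sum.remove)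
  have sub: "convex_cone hull (A - {a}) \<subseteq> convex_cone hull A" by (rule hull_mono) auto
  have fin: "finite (A - {a})" using assms(1) by simp
  have mem: "x' \<in> convex_cone hull (A - {a})" "y' \<in> convex_cone hull (A - {a})"
    using c(1) d(1) by (auto simp: convex_cone_hull_finite[OF fin] x'_def y'_def)
  then have g: "x' + y' \<in> convex_cone hull (A - {a})" by (rule convex_cone_hull_add)
  define e where "e = c a + d a"
  have eq: "x' + y' = (s - e) *\<^sub>R a"
    using assms(7) by (simp add: xy e_def algebra_simps)
  have "s \<le> e"
  proof (rule ccontr)
    assume "\<not> s \<le> e"
    then have "a = (1 / (s - e)) *\<^sub>R (x' + y')" by (simp add: eq)
    also have "\<dots> \<in> convex_cone hull (A - {a})"
      using g \<open>\<not> s \<le> e\<close> by (intro convex_cone_hull_mul) auto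
    finally show False using assms(3) by blast
  qed
  moreover have "a \<in> convex_cone hull A" using assms(2) by (rule hull_inc)
  ultimately have "(e - s) *\<^sub>R a \<in> convex_cone hull A" by (intro convex_cone_hull_mul) auto
  moreover have "(e - s) *\<^sub>R a = - (x' + y')" by (simp add: eq algebra_simps)
  ultimately have "x' + y' = 0" using g sub pointed by (metis subsetD)
  then have "y' = - x'" by (simp add: eq_neg_iff_add_eq_0 add.commute)
  then have "x' = 0" using mem sub pointed by auto
  then show ?thesis using c(1)[of a] xy by auto
qed

text \<open>The ray from \<open>v\<close> through \<open>w\<close> is extreme, so a segment of
  \<open>P\<close> with an inner point on \<open>closed_segment v w\<close> lies along that ray. No
  point of \<open>P\<close> on the ray lies beyond \<open>w\<close>, because \<open>w\<close> is
  extreme too. Hence the segment is a face.\<close>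

lemma adjacent_if_irredundant:
  fixes P :: "(real ^ 'd) set"
  assumes P: "P = convex hull W" and W: "W = vertices P" and "v \<in> W" "w \<in> W" "v \<noteq> w"
    and A: "finite A" "w - v \<in> A" "w - v \<notin> convex_cone hull (A - {w - v})"
    and C: "convex_cone hull A = convex_cone hull ((\<lambda>w. w - v) ` W)"
  shows "adjacent P v w"
proof -
  have ext: "v extreme_point_of P" "w extreme_point_of P"
    using W assms(3,4) by (auto simp: vertices_def)
  then have vw: "v \<in> P" "w \<in> P" by (auto simp: extreme_point_of_def)
  have cP: "convex P" by (simp add: P)
  have pointed: "x = 0" if "x \<in> convex_cone hull A" "- x \<in> convex_cone hull A" for x
    using pointed_tangent_cone[OF ext(1) P assms(3)] that C by auto
  have mem: "s *\<^sub>R (b - v) \<in> convex_cone hull A" if "b \<in> P" "0 \<le> s" for b s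
    using that unfolding C convex_cone_hull_translate[OF assms(3)] by (auto simp: P)
  have main: "a \<in> closed_segment v w"
    if ab: "a \<in> P" "b \<in> P" "0 < u" "u < 1" and t: "(1 - u) *\<^sub>R a + u *\<^sub>R b = v + t *\<^sub>R (w - v)"
    for a b u t
  proof -
    have "(1 - u) *\<^sub>R (a - v) + u *\<^sub>R (b - v) = t *\<^sub>R (w - v)"
      using t by (simp add: algebra_simps)
    then obtain r where r: "0 \<le> r" "(1 - u) *\<^sub>R (a - v) = r *\<^sub>R (w - v)"
      using tangent_cone_irredundant_ray[OF A pointed mem[OF ab(1), of "1 - u"] mem[OF ab(2), of u]]
        ab by auto
    define q where "q = r / (1 - u)"
    have q: "0 \<le> q" using r ab by (simp add: q_def)
    have "a - v = (1 / (1 - u)) *\<^sub>R ((1 - u) *\<^sub>R (a - v))" using ab by simp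
    also have "\<dots> = q *\<^sub>R (w - v)" by (simp add: r(2) q_def)
    finally have a: "a = v + q *\<^sub>R (w - v)" by (simp add: algebra_simps)
    have "q \<le> 1"
    proof (rule ccontr)
      assume "\<not> q \<le> 1"
      then have "w = (1 - 1 / q) *\<^sub>R v + (1 / q) *\<^sub>R a"
        by (simp add: a algebra_simps)
      moreover have "v \<noteq> a" using \<open>\<not> q \<le> 1\<close> assms(5) by (auto simp: a)
      moreover have "0 < 1 / q" "1 / q < 1" using \<open>\<not> q \<le> 1\<close> by auto
      ultimately have "w \<in> open_segment v a"
        unfolding in_segment by (intro conjI exI[of _ "1 / q"])
      with ext(2) vw(1) ab(1) show False by (auto simp: extreme_point_of_def)
    qed
    with q show ?thesis
      unfolding in_segment by (intro exI[of _ q]) (simp add: a algebra_simps)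
  qed
  have "closed_segment v w face_of P"
    unfolding face_of_def
  proof (intro conjI ballI impI)
    show "closed_segment v w \<subseteq> P" using vw cP by (simp add: closed_segment_subset)
    show "convex (closed_segment v w)" by simp
    fix a b x assume ab: "a \<in> P" "b \<in> P" and x: "x \<in> closed_segment v w" "x \<in> open_segment a b"
    obtain t where "x = v + t *\<^sub>R (w - v)" using x(1) by (auto simp: in_segment algebra_simps)
    moreover obtain u where u: "0 < u" "u < 1" "x = (1 - u) *\<^sub>R a + u *\<^sub>R b"
      using x(2) by (auto simp: in_segment)
    ultimately have eq: "(1 - u) *\<^sub>R a + u *\<^sub>R b = v + t *\<^sub>R (w - v)" by simp
    show "a \<in> closed_segment v w" using main[OF ab u(1,2) eq] .
    show "b \<in> closed_segment v w"
      using main[OF ab(2,1), of "1 - u" t] u eq by (simp add: add.commute)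
  qed
  moreover have "aff_dim (closed_segment v w) = 1"
    using assms(5) by (simp add: segment_convex_hull aff_dim_convex_hull aff_dim_2)
  ultimately show ?thesis
    using assms(3,4) W by (simp add: adjacent_def edge_of_def)
qed

lemma adjacent_neq: "adjacent P v w \<Longrightarrow> v \<noteq> w"
  by (auto simp: adjacent_def edge_of_def)

text \<open>A generating set of least size among the displacements \<open>w - v\<close> consists of
  irredundant generators, and these are edge directions.\<close>

lemma tangent_cone_edges:
  fixes P :: "(real ^ 'd) set"
  assumes P: "P = convex hull W" and W: "W = vertices P" and "v \<in> W" "finite W"
  shows "convex_cone hull ((\<lambda>w. w - v) ` W) = convex_cone hull ((\<lambda>w. w - v) ` {w. adjacent P v w})"
proof
  let ?C = "convex_cone hull ((\<lambda>w. w - v) ` W)"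
  define S where "S = (\<lambda>w. w - v) ` (W - {v})"
  have "finite S" using assms(4) by (simp add: S_def)
  have "(\<lambda>w. w - v) ` W = insert 0 S"
    using assms(3) by (auto simp: S_def image_iff)
  then have "convex_cone hull S = ?C"
    by (simp add: hull_redundant convex_cone_hull_contains_0)
  then obtain A where A: "A \<subseteq> S" "convex_cone hull A = ?C"
    and min: "\<And>A'. A' \<subseteq> S \<Longrightarrow> convex_cone hull A' = ?C \<Longrightarrow> card A \<le> card A'"
    using ex_has_least_nat[of "\<lambda>A. A \<subseteq> S \<and> convex_cone hull A = ?C" S card] by auto
  have finA: "finite A" using A(1) \<open>finite S\<close> finite_subset by blast
  have "A \<subseteq> (\<lambda>w. w - v) ` {w. adjacent P v w}"
  proof
    fix a assume a: "a \<in> A"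
    then obtain w where w: "a = w - v" "w \<in> W" "w \<noteq> v" using A(1) by (auto simp: S_def)
    have "a \<notin> convex_cone hull (A - {a})"
    proof
      assume "a \<in> convex_cone hull (A - {a})"
      then have "convex_cone hull (insert a (A - {a})) = convex_cone hull (A - {a})"
        by (rule hull_redundant)
      then have "convex_cone hull (A - {a}) = ?C" using a A(2) by (simp add: insert_absorb)
      then have "card A \<le> card (A - {a})" using A(1) by (intro min) auto
      then show False using a finA by (metis card_Diff1_less not_le)
    qed
    then have "adjacent P v w"
      using adjacent_if_irredundant[OF P W assms(3) w(2) _ finA _ _ A(2)] a w by auto
    then show "a \<in> (\<lambda>w. w - v) ` {w. adjacent P v w}" using w by auto
  qed
  then show "?C \<subseteq> convex_cone hull ((\<lambda>w. w - v) ` {w. adjacent P v w})"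
    using A(2) by (metis hull_mono)
  show "convex_cone hull ((\<lambda>w. w - v) ` {w. adjacent P v w}) \<subseteq> ?C"
    using W by (intro hull_mono) (auto simp: adjacent_def)
qed

section \<open>Vertices and denominator of a rational polytope\<close>

lemma rational_polytope_vertices:
  fixes P :: "(real ^ 'd) set"
  assumes "rational_polytope P"
  shows "finite (vertices P)" "vertices P \<noteq> {}" "P = convex hull (vertices P)"
    "v \<in> vertices P \<Longrightarrow> v $ j \<in> \<rat>"
proof -
  obtain S :: "(real ^ 'd) set" where S: "finite S" "S \<noteq> {}" "\<forall>v\<in>S. \<forall>j. v $ j \<in> \<rat>" "P = convex hull S"
    using assms by (auto simp: rational_polytope_def)
  then have sub: "vertices P \<subseteq> S"
    using extreme_points_of_convex_hull by (auto simp: vertices_def)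
  then show "finite (vertices P)" using S(1) finite_subset by blast
  show "v \<in> vertices P \<Longrightarrow> v $ j \<in> \<rat>" using sub S(3) by blast
  show "P = convex hull (vertices P)"
    using Krein_Milman_Minkowski[of P] S by (simp add: vertices_def finite_imp_compact_convex_hull)
  then show "vertices P \<noteq> {}" using S by auto
qed

lemma vertices_dilate:
  assumes "0 < t"
  shows "vertices (dilate t P) = (\<lambda>x. of_nat t *\<^sub>R x) ` vertices P"
proof -
  let ?f = "\<lambda>x. of_nat t *\<^sub>R x"
  have "?f x extreme_point_of ?f ` P \<longleftrightarrow> x extreme_point_of P" for x
    using face_of_linear_image[of ?f "{x}" P] assms
    by (simp add: face_of_singleton inj_on_def linear_scaleR)
  moreover have "y \<in> ?f ` P" if "y extreme_point_of ?f ` P" for y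
    using that by (simp add: extreme_point_of_def)
  ultimately have "{v. v extreme_point_of ?f ` P} = ?f ` {v. v extreme_point_of P}"
    by blast
  then show ?thesis by (simp add: vertices_def dilate_def)
qed

text \<open>A common denominator of all vertex coordinates shows that the least number in the
  definition of \<open>denominator\<close> is taken over a nonempty set.\<close>

lemma denominator_integral:
  fixes P :: "(real ^ 'd) set"
  assumes "rational_polytope P"
  shows "0 < denominator P" "v \<in> vertices P \<Longrightarrow> of_nat (denominator P) *\<^sub>R v \<in> range rvec"
proof -
  note W = rational_polytope_vertices[OF assms]
  let ?Q = "\<lambda>p. p > 0 \<and> vertices (dilate p P) \<subseteq> range rvec"
  have "\<exists>n>0. \<forall>x\<in>X. of_nat n * x \<in> \<int>" if "finite X" "X \<subseteq> \<rat>" for X :: "real set"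
    using that
  proof (induction X rule: finite_induct)
    case empty
    show ?case by (intro exI[of _ 1]) auto
  next
    case (insert x X)
    then obtain n :: nat where n: "0 < n" "\<forall>x\<in>X. of_nat n * x \<in> \<int>" by auto
    obtain a b where ab: "b > 0" "x = of_int a / of_int b"
      using insert.prems by (metis Rats_cases' insert_subset)
    have "of_nat (n * nat b) * y \<in> \<int>" if "y \<in> insert x X" for y
    proof (cases "y = x")
      case True
      then have "of_nat (n * nat b) * y = of_int (int n * a)" using ab by simp
      then show ?thesis by (metis Ints_of_int)
    next
      case False
      then have "of_nat n * y \<in> \<int>" using n that by auto
      then have "of_int b * (of_nat n * y) \<in> \<int>" by (intro Ints_mult[OF Ints_of_int])
      moreover have "of_nat (n * nat b) * y = of_int b * (of_nat n * y)" using ab by simp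
      ultimately show ?thesis by metis
    qed
    then show ?case using n(1) ab(1) by (intro exI[of _ "n * nat b"]) auto
  qed
  from this[of "(\<lambda>(v, j). v $ j) ` (vertices P \<times> UNIV)"] W(1,4)
  obtain n :: nat where n: "0 < n" "\<And>v j. v \<in> vertices P \<Longrightarrow> of_nat n * v $ j \<in> \<int>"
    by (auto simp: image_subset_iff)
  have "of_nat n *\<^sub>R v \<in> range rvec" if "v \<in> vertices P" for v
  proof -
    have "\<forall>j. \<exists>m. of_nat n * v $ j = of_int m" using n(2)[OF that] by (auto elim!: Ints_cases)
    then obtain m where "\<And>j. of_nat n * v $ j = of_int (m j)" by metis
    then have "of_nat n *\<^sub>R v = rvec (\<chi> j. m j)" by (simp add: rvec_def vec_eq_iff)
    then show ?thesis by blast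
  qed
  then have "?Q n" using n(1) by (auto simp: vertices_dilate)
  then have "?Q (denominator P)" unfolding denominator_def by (rule LeastI)
  then show "0 < denominator P" "v \<in> vertices P \<Longrightarrow> of_nat (denominator P) *\<^sub>R v \<in> range rvec"
    by (auto simp: vertices_dilate)
qed

section \<open>Rational functions in \<open>q\<close>\<close>

definition rpoly :: "rat poly \<Rightarrow> complex \<Rightarrow> complex" where
  "rpoly b z = poly (map_poly of_rat b) z"

lemma rpoly_pCons: "rpoly (pCons c b) z = of_rat c + z * rpoly b z"
  by (simp add: rpoly_def map_poly_pCons)

lemma rpoly_0: "rpoly 0 z = 0"
  by (simp add: rpoly_def)

lemma rpoly_add: "rpoly (a + b) z = rpoly a z + rpoly b z"
proof -
  have "map_poly of_rat (a + b) = (map_poly of_rat a + map_poly of_rat b :: complex poly)"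
    by (intro poly_eqI) (simp add: coeff_map_poly of_rat_add)
  then show ?thesis by (simp add: rpoly_def)
qed

lemma rpoly_smult: "rpoly (smult c b) z = of_rat c * rpoly b z"
proof -
  have "map_poly of_rat (smult c b) = (smult (of_rat c) (map_poly of_rat b) :: complex poly)"
    by (intro poly_eqI) (simp add: coeff_map_poly of_rat_mult)
  then show ?thesis by (simp add: rpoly_def)
qed

lemma rpoly_mult: "rpoly (a * b) z = rpoly a z * rpoly b z"
  by (induction a) (simp_all add: rpoly_0 rpoly_pCons rpoly_add rpoly_smult mult_pCons_left algebra_simps)

lemma rpoly_monom: "rpoly (monom 1 n) z = z ^ n"
  by (simp add: rpoly_def map_poly_monom poly_monom)

text \<open>Any representing fraction is allowed, not only the reduced one, which makes closure
  under sums and products immediate.\<close>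

definition regular_at :: "complex \<Rightarrow> ratfun \<Rightarrow> bool" where
  "regular_at z f \<longleftrightarrow> (\<exists>a b. f = to_fract a / to_fract b \<and> rpoly b z \<noteq> 0)"

lemma regular_at_to_fract: "regular_at z (to_fract a)"
  unfolding regular_at_def
  by (intro exI[of _ a] exI[of _ 1]) (simp add: rpoly_def)

lemma regular_at_add:
  assumes "regular_at z f" "regular_at z g"
  shows "regular_at z (f + g)"
proof -
  obtain a b where f: "f = to_fract a / to_fract b" "rpoly b z \<noteq> 0"
    using assms(1) by (auto simp: regular_at_def)
  obtain c d where g: "g = to_fract c / to_fract d" "rpoly d z \<noteq> 0"
    using assms(2) by (auto simp: regular_at_def)
  have "to_fract b \<noteq> 0" "to_fract d \<noteq> 0" using f g by (auto simp: rpoly_0)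
  then have "f + g = to_fract (a * d + c * b) / to_fract (b * d)"
    by (simp add: f g divide_simps)
  then show ?thesis using f g unfolding regular_at_def
    by (intro exI[of _ "a * d + c * b"] exI[of _ "b * d"]) (simp add: rpoly_mult)
qed

lemma regular_at_mult:
  assumes "regular_at z f" "regular_at z g"
  shows "regular_at z (f * g)"
proof -
  obtain a b where f: "f = to_fract a / to_fract b" "rpoly b z \<noteq> 0"
    using assms(1) by (auto simp: regular_at_def)
  obtain c d where g: "g = to_fract c / to_fract d" "rpoly d z \<noteq> 0"
    using assms(2) by (auto simp: regular_at_def)
  have "f * g = to_fract (a * c) / to_fract (b * d)"
    by (simp add: f g)
  then show ?thesis using f g unfolding regular_at_def
    by (intro exI[of _ "a * c"] exI[of _ "b * d"]) (simp add: rpoly_mult)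
qed

lemma to_fract_of_int: "to_fract (of_int n) = (of_int n :: ratfun)"
proof -
  have "to_fract (of_nat k) = (of_nat k :: ratfun)" for k
    by (induction k) simp_all
  then show ?thesis by (cases n rule: int_cases2) simp_all
qed

lemma regular_at_of_int: "regular_at z (of_int n)"
  using regular_at_to_fract[of z "of_int n"] by (simp only: to_fract_of_int)

lemma regular_at_sum: "(\<And>x. x \<in> A \<Longrightarrow> regular_at z (f x)) \<Longrightarrow> regular_at z (sum f A)"
  using regular_at_to_fract[of z 0]
  by (induction A rule: infinite_finite_induct) (auto intro: regular_at_add)

lemma regular_at_prod_list:
  "(\<And>x. x \<in> set xs \<Longrightarrow> regular_at z (f x)) \<Longrightarrow> regular_at z (\<Prod>x\<leftarrow>xs. f x)"
  using regular_at_to_fract[of z 1] by (induction xs) (auto intro: regular_at_mult)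

text \<open>The reduced denominator divides every other denominator of \<open>f\<close>.\<close>

lemma regular_at_not_pole:
  assumes "regular_at z f"
  shows "\<not> is_pole_of z f"
proof
  assume pole: "is_pole_of z f"
  obtain a b where f: "f = to_fract a / to_fract b" "rpoly b z \<noteq> 0"
    using assms by (auto simp: regular_at_def)
  define c d where "c = fst (quot_of_fract f)" and "d = snd (quot_of_fract f)"
  have d: "to_fract d \<noteq> 0" "coprime c d"
    by (simp_all add: d_def c_def coprime_quot_of_fract)
  have "f = to_fract c / to_fract d"
    by (metis Fract_quot_of_fract Fract_conv_to_fract c_def d_def)
  moreover have "to_fract b \<noteq> 0" using f by (auto simp: rpoly_0)
  ultimately have "to_fract a * to_fract d = to_fract c * to_fract b"
    using f(1) d(1) by (simp add: frac_eq_eq)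
  then have "a * d = c * b" by (metis to_fract_eq_iff to_fract_mult)
  then have "d dvd c * b" by (metis dvd_triv_right)
  then have "d dvd b" using d(2) by (simp add: coprime_commute coprime_dvd_mult_right_iff)
  then obtain e where "b = d * e" by (auto elim: dvdE)
  moreover have "rpoly d z = 0" using pole by (simp add: is_pole_of_def rpoly_def d_def)
  ultimately show False using f(2) by (simp add: rpoly_mult)
qed

section \<open>Powers of \<open>q\<close>, edge factors and Laurent sums\<close>

lemma qvar_power: "qvar ^ n = to_fract (monom 1 n)"
proof -
  have q: "qvar = to_fract (monom 1 1)" by (simp add: qvar_def to_fract_def monom_altdef)
  show ?thesis
  proof (induction n)
    case (Suc n)
    have "qvar ^ Suc n = to_fract (monom 1 1 * monom 1 n)"
      by (simp only: power_Suc Suc.IH to_fract_mult q[symmetric])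
    then show ?case by (simp only: mult_monom mult_1 plus_1_eq_Suc)
  qed simp
qed

lemma qvar_nonzero: "qvar \<noteq> 0"
  using qvar_power[of 1] to_fract_eq_0_iff[of "monom (1::rat) 1"] by (metis monom_eq_0_iff one_neq_zero power_one_right)

lemma qvar_powi_eq_1_iff: "qvar powi n = 1 \<longleftrightarrow> n = 0"
proof
  have *: "m = 0" if "qvar ^ m = 1" for m
  proof -
    have "monom (1::rat) m = monom 1 0" using that by (simp add: qvar_power flip: to_fract_1)
    then show ?thesis by (metis degree_monom_eq zero_neq_one)
  qed
  assume "qvar powi n = 1"
  then show "n = 0" using *[of "nat n"] *[of "nat (- n)"]
    by (auto simp: power_int_def power_inverse split: if_splits)
qed simp

lemma regular_at_qvar_power: "regular_at z (qvar ^ n)"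
  by (simp add: qvar_power regular_at_to_fract)

lemma regular_at_inverse_qvar:
  assumes "z ^ n \<noteq> 1"
  shows "regular_at z (1 / (1 - qvar ^ n))"
  unfolding regular_at_def
proof (intro exI conjI)
  show "1 / (1 - qvar ^ n) = to_fract 1 / to_fract (1 - monom 1 n)"
    by (simp add: qvar_power)
  have "rpoly (1 - monom 1 n) z + rpoly (monom 1 n) z = 1"
    by (simp flip: rpoly_add) (simp add: rpoly_def)
  then show "rpoly (1 - monom 1 n) z \<noteq> 0" using assms by (auto simp: rpoly_monom)
qed

text \<open>The power of \<open>q\<close> is the one that clears the pole at \<open>0\<close> if \<open>m\<close> is negative.\<close>

lemma regular_at_edge_factor:
  assumes "z ^ nat \<bar>m\<bar> \<noteq> 1"
  shows "regular_at z (qvar powi min 0 m / (1 - qvar powi m))"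
proof (cases "0 \<le> m")
  case True
  then show ?thesis using regular_at_inverse_qvar[of z "nat m"] assms
    by (simp add: power_int_def)
next
  case False
  have "qvar powi m / (1 - qvar powi m) = - (1 / (1 - qvar powi (- m)))"
  proof -
    have "qvar powi m \<noteq> 1" "qvar powi m \<noteq> 0"
      using False by (auto simp: qvar_powi_eq_1_iff qvar_nonzero)
    then show ?thesis by (simp add: power_int_minus divide_simps)
  qed
  also have "\<dots> = to_fract (- 1) * (1 / (1 - qvar ^ nat \<bar>m\<bar>))"
    using False by (simp add: power_int_def)
  finally have "qvar powi min 0 m / (1 - qvar powi m) = to_fract (- 1) * (1 / (1 - qvar ^ nat \<bar>m\<bar>))"
    using False by (simp add: min_def)
  then show ?thesis
    using regular_at_mult[OF regular_at_to_fract regular_at_inverse_qvar[OF assms]] by metis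
qed

text \<open>Multiplication by \<open>q^K\<close> makes all exponents nonnegative; the hypothesis
  then says that the coefficient of the resulting polynomial at \<open>m + K\<close> is
  nonzero.\<close>

lemma qvar_sum_nonzero:
  assumes "finite A" "(\<Sum>y\<in>{y\<in>A. e y = m}. c y) \<noteq> (0::int)"
  shows "(\<Sum>y\<in>A. of_int (c y) * qvar powi (e y)) \<noteq> 0"
proof -
  define K where "K = (\<Sum>y\<in>A. nat \<bar>e y\<bar>)"
  have K: "0 \<le> e y + int K" if "y \<in> A" for y
  proof -
    have "nat \<bar>e y\<bar> \<le> K"
      unfolding K_def using that assms(1) by (intro member_le_sum) auto
    then show ?thesis by linarith
  qed
  define g where "g = (\<Sum>y\<in>A. monom (of_int (c y) :: rat) (nat (e y + int K)))"
  have "(\<Sum>y\<in>A. of_int (c y) * qvar powi (e y)) * qvar ^ K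
      = (\<Sum>y\<in>A. of_int (c y) * qvar ^ nat (e y + int K))"
    unfolding sum_distrib_right
  proof (rule sum.cong)
    fix y assume "y \<in> A"
    have "qvar powi (e y) * qvar ^ K = qvar powi (e y + int K)"
      by (simp add: power_int_add qvar_nonzero)
    also have "\<dots> = qvar ^ nat (e y + int K)"
      using K[OF \<open>y \<in> A\<close>] by (simp add: power_int_def)
    finally have "qvar powi (e y) * qvar ^ K = qvar ^ nat (e y + int K)" .
    then show "of_int (c y) * qvar powi (e y) * qvar ^ K = of_int (c y) * qvar ^ nat (e y + int K)"
      by (simp add: mult.assoc)
  qed simp
  also have "\<dots> = to_fract g"
    unfolding g_def to_fract_sum
  proof (rule sum.cong)
    fix y
    have "monom (of_int (c y) :: rat) (nat (e y + int K)) = of_int (c y) * monom 1 (nat (e y + int K))"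
      by (simp add: of_int_poly smult_monom)
    then show "of_int (c y) * qvar ^ nat (e y + int K)
        = to_fract (monom (of_int (c y)) (nat (e y + int K)))"
      by (simp add: qvar_power to_fract_of_int)
  qed simp
  finally have eq: "(\<Sum>y\<in>A. of_int (c y) * qvar powi (e y)) * qvar ^ K = to_fract g" .
  have "{y\<in>A. e y = m} \<noteq> {}" using assms(2) by (metis sum.empty)
  then have m: "0 \<le> m + int K" using K by auto
  have "coeff g (nat (m + int K)) = (\<Sum>y\<in>A. if e y = m then of_int (c y) else 0)"
    unfolding g_def coeff_sum
  proof (rule sum.cong)
    fix y assume "y \<in> A"
    then have "nat (e y + int K) = nat (m + int K) \<longleftrightarrow> e y = m"
      using K[of y] m by auto
    then show "coeff (monom (of_int (c y)) (nat (e y + int K))) (nat (m + int K))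
        = (if e y = m then of_int (c y) else (0::rat))" by simp
  qed simp
  also have "\<dots> = of_int (\<Sum>y\<in>{y\<in>A. e y = m}. c y)"
    using assms(1) by (simp add: sum.inter_filter if_distrib[of rat_of_int] cong: if_cong)
  finally have "coeff g (nat (m + int K)) = of_int (\<Sum>y\<in>{y\<in>A. e y = m}. c y)" .
  then have "g \<noteq> 0" using assms(2) by (metis coeff_0 of_int_eq_0_iff)
  then show ?thesis using eq by auto
qed

section \<open>Specialisation of finitely supported functions\<close>

text \<open>The generating function of \<open>f\<close> at \<open>x_j = q^(l_j)\<close>. It is
  meaningful for finite support; a sum over an infinite support is zero by convention.\<close>

definition ev :: "int ^ 'd \<Rightarrow> (int ^ 'd \<Rightarrow> int) \<Rightarrow> ratfun" where
  "ev l f = (\<Sum>y\<in>{y. f y \<noteq> 0}. of_int (f y) * qvar powi form l y)"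

lemma form_0: "form l 0 = 0"
  by (simp add: form_def)

lemma form_diff: "form l (x - y) = form l x - form l y"
  by (simp add: form_def algebra_simps sum_subtractf)

lemma form_add: "form l (x + y) = form l x + form l y"
  by (simp add: form_def algebra_simps sum.distrib)

lemma form_nmul: "form l (nmul n x) = int n * (form l x :: int)"
  by (simp add: form_def nmul_component sum_distrib_left mult_ac)

lemma form_rvec: "form l (rvec x) = of_int (form l x)"
  by (simp add: form_def rvec_def)

lemma form_scaleR: "form l (c *\<^sub>R x) = c * (form l x :: real)"
  by (simp add: form_def sum_distrib_left mult_ac)

lemma ev_superset:
  assumes "finite A" "{y. f y \<noteq> 0} \<subseteq> A"
  shows "ev l f = (\<Sum>y\<in>A. of_int (f y) * qvar powi form l y)"
  unfolding ev_def using assms by (intro sum.mono_neutral_left) auto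

lemma ev_shift: "ev l (\<lambda>y. f (y - a)) = qvar powi form l a * ev l f"
proof -
  have "ev l (\<lambda>y. f (y - a)) = (\<Sum>y\<in>{y. f y \<noteq> 0}. of_int (f y) * qvar powi form l (y + a))"
    unfolding ev_def
    by (rule sum.reindex_bij_witness[of _ "\<lambda>y. y + a" "\<lambda>y. y - a"]) auto
  also have "\<dots> = (\<Sum>y\<in>{y. f y \<noteq> 0}. qvar powi form l a * (of_int (f y) * qvar powi form l y))"
    by (intro sum.cong) (auto simp: form_add power_int_add qvar_nonzero mult_ac)
  finally show ?thesis by (simp add: ev_def sum_distrib_left)
qed

lemma ev_minus:
  assumes "finsupp f" "finsupp g"
  shows "ev l (\<lambda>y. f y - g y) = ev l f - ev l g"
proof -
  have fin: "finite ({y. f y \<noteq> 0} \<union> {y. g y \<noteq> 0})" (is "finite ?A")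
    using assms by (auto simp: finsupp_def)
  have "ev l (\<lambda>y. f y - g y) = (\<Sum>y\<in>?A. of_int (f y - g y) * qvar powi form l y)"
    by (rule ev_superset[OF fin]) auto
  moreover have "ev l f = (\<Sum>y\<in>?A. of_int (f y) * qvar powi form l y)"
    by (rule ev_superset[OF fin]) auto
  moreover have "ev l g = (\<Sum>y\<in>?A. of_int (g y) * qvar powi form l y)"
    by (rule ev_superset[OF fin]) auto
  ultimately show ?thesis by (simp add: left_diff_distrib sum_subtractf)
qed

lemma ev_sum:
  assumes "finite W" "\<And>v. v \<in> W \<Longrightarrow> finsupp (f v)"
  shows "ev l (\<lambda>y. \<Sum>v\<in>W. f v y) = (\<Sum>v\<in>W. ev l (f v))"
proof -
  let ?A = "\<Union>v\<in>W. {y. f v y \<noteq> 0}"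
  have fin: "finite ?A" using assms by (auto simp: finsupp_def)
  have "ev l (\<lambda>y. \<Sum>v\<in>W. f v y) = (\<Sum>y\<in>?A. of_int (\<Sum>v\<in>W. f v y) * qvar powi form l y)"
    by (rule ev_superset[OF fin]) (auto dest: sum.not_neutral_contains_not_neutral)
  also have "\<dots> = (\<Sum>v\<in>W. \<Sum>y\<in>?A. of_int (f v y) * qvar powi form l y)"
    by (subst sum.swap) (simp add: sum_distrib_right)
  also have "\<dots> = (\<Sum>v\<in>W. ev l (f v))"
    by (intro sum.cong ev_superset[OF fin, symmetric]) auto
  finally show ?thesis .
qed

lemma ev_diffs:
  assumes "finsupp f"
  shows "ev l (diffs us f) = (\<Prod>u\<leftarrow>us. 1 - qvar powi form l u) * ev l f"
  using assms
proof (induction us arbitrary: f)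
  case (Cons u us)
  have "ev l (diff1 u f) = (1 - qvar powi form l u) * ev l f"
    unfolding diff1_def[abs_def] using Cons.prems
    by (simp add: ev_minus finsupp_shift ev_shift algebra_simps)
  then show ?case using Cons by (simp add: finsupp_diff1 mult_ac)
qed simp

section \<open>Brion's identity\<close>

lemma rvec_add: "rvec (x + y) = rvec x + rvec y"
  by (simp add: rvec_def vec_eq_iff)

lemma rvec_diff: "rvec (x - y) = rvec x - rvec y"
  by (simp add: rvec_def vec_eq_iff)

lemma rvec_0: "rvec 0 = 0"
  by (simp add: rvec_def vec_eq_iff)

lemma rvec_nmul: "rvec (nmul n x) = of_nat n *\<^sub>R rvec x"
  by (simp add: rvec_def vec_eq_iff nmul_component)

lemma rvec_eq_iff: "rvec x = rvec y \<longleftrightarrow> x = y"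
  by (simp add: rvec_def vec_eq_iff)

lemma finite_rvec_bounded: "finite {y :: int ^ 'd. norm (rvec y) \<le> R}"
proof -
  let ?S = "{- \<lceil>R\<rceil>..\<lceil>R\<rceil>}"
  have "{y :: int ^ 'd. norm (rvec y) \<le> R} \<subseteq> vec_lambda ` (UNIV \<rightarrow>\<^sub>E ?S)"
  proof
    fix y :: "int ^ 'd" assume "y \<in> {y. norm (rvec y) \<le> R}"
    then have "\<bar>rvec y $ i\<bar> \<le> R" for i
      using component_le_norm_cart[of "rvec y" i] by simp
    then have "\<bar>of_int (y $ i)\<bar> \<le> R" for i by (simp add: rvec_def)
    then have "y $ i \<in> ?S" for i
      by (smt (verit) atLeastAtMost_iff le_of_int_ceiling of_int_le_iff of_int_minus)
    then have "vec_nth y \<in> UNIV \<rightarrow>\<^sub>E ?S" by auto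
    then show "y \<in> vec_lambda ` (UNIV \<rightarrow>\<^sub>E ?S)" by (metis image_eqI vec_lambda_eta)
  qed
  then show ?thesis by (rule finite_subset) (intro finite_imageI finite_PiE, auto)
qed

section \<open>Tangent cones and dilates of a rational polytope\<close>

locale rational_polytope_data =
  fixes P :: "(real ^ 'd) set"
  assumes rational: "rational_polytope P"
begin

definition p :: nat where "p = denominator P"

abbreviation W :: "(real ^ 'd) set" where "W \<equiv> vertices P"

text \<open>The lattice vector \<open>p v\<close>, specified only where \<open>p v\<close> is
  integral, in particular at the vertices.\<close>

definition V :: "real ^ 'd \<Rightarrow> int ^ 'd" where
  "V v = (SOME m. rvec m = of_nat p *\<^sub>R v)"

text \<open>The tangent cone at \<open>v\<close> with its apex moved to the origin, so that
  \<open>t P\<close> has the tangent cone \<open>t v + C v\<close> at \<open>t v\<close>.\<close>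

definition C :: "real ^ 'd \<Rightarrow> (real ^ 'd) set" where
  "C v = convex_cone hull ((\<lambda>w. w - v) ` W)"

definition indP :: "nat \<Rightarrow> int ^ 'd \<Rightarrow> int" where
  "indP t y = of_bool (rvec y \<in> dilate t P)"

definition indT :: "real ^ 'd \<Rightarrow> nat \<Rightarrow> int ^ 'd \<Rightarrow> int" where
  "indT v t y = of_bool (rvec y - of_nat t *\<^sub>R v \<in> C v)"

definition brion_error :: "nat \<Rightarrow> int ^ 'd \<Rightarrow> int" where
  "brion_error t y = indP t y - (\<Sum>v\<in>W. indT v t y)"

lemmas finite_W = rational_polytope_vertices(1)[OF rational]
lemmas W_nonempty = rational_polytope_vertices(2)[OF rational]
lemmas P_eq = rational_polytope_vertices(3)[OF rational]

lemma p_pos: "0 < p"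
  using denominator_integral(1)[OF rational] by (simp add: p_def)

lemma rvec_V:
  assumes "v \<in> W"
  shows "rvec (V v) = of_nat p *\<^sub>R v"
proof -
  obtain m where "rvec m = of_nat p *\<^sub>R v"
    using denominator_integral(2)[OF rational assms] by (metis imageE p_def)
  then show ?thesis unfolding V_def by (rule someI)
qed

lemma V_eq_iff: "v \<in> W \<Longrightarrow> w \<in> W \<Longrightarrow> V v = V w \<longleftrightarrow> v = w"
  using p_pos by (auto simp: rvec_V simp flip: rvec_eq_iff)

lemma W_subset: "v \<in> W \<Longrightarrow> v \<in> P"
  by (auto simp: vertices_def extreme_point_of_def)

lemma convex_P: "convex P"
  by (subst P_eq) simp

lemma bounded_P: "bounded P"
  by (subst P_eq) (simp add: bounded_convex_hull finite_W finite_imp_bounded)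

lemma C_eq: "v \<in> W \<Longrightarrow> C v = {s *\<^sub>R (a - v) | s a. 0 \<le> s \<and> a \<in> P}"
  unfolding C_def by (subst convex_cone_hull_translate) (simp_all flip: P_eq)

lemma C_scale: "0 < s \<Longrightarrow> s *\<^sub>R x \<in> C v \<longleftrightarrow> x \<in> C v"
  using convex_cone_hull_mul[of x "(\<lambda>w. w - v) ` W" s]
    convex_cone_hull_mul[of "s *\<^sub>R x" "(\<lambda>w. w - v) ` W" "1 / s"]
  by (auto simp: C_def)

lemma C_add: "x \<in> C v \<Longrightarrow> y \<in> C v \<Longrightarrow> x + y \<in> C v"
  by (simp add: C_def convex_cone_hull_add)

lemma closed_C: "closed (C v)"
  by (simp add: C_def closed_convex_cone_hull finite_W)

lemma dilate_0: "dilate 0 P = {0}"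
  using W_nonempty W_subset by (auto simp: dilate_def)

lemma dilate_iff: "0 < t \<Longrightarrow> x \<in> dilate t P \<longleftrightarrow> (1 / of_nat t) *\<^sub>R x \<in> P"
  by (force simp: dilate_def image_iff intro: bexI[of _ "(1 / of_nat t) *\<^sub>R x"])

lemma finite_lattice_points: "finite {y. rvec y \<in> dilate t P}"
proof -
  obtain R where R: "\<And>x. x \<in> P \<Longrightarrow> norm x \<le> R" using bounded_P by (auto simp: bounded_iff)
  have "norm x \<le> of_nat t * R" if "x \<in> dilate t P" for x
    using that by (auto simp: dilate_def intro!: mult_left_mono R)
  then have "{y. rvec y \<in> dilate t P} \<subseteq> {y. norm (rvec y) \<le> of_nat t * R}" by auto
  then show ?thesis by (rule finite_subset) (rule finite_rvec_bounded)
qed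

lemma finsupp_indP: "finsupp (indP t)"
  using finite_lattice_points[of t] by (simp add: finsupp_def indP_def)

text \<open>The pairs \<open>(y, t)\<close> with \<open>y\<close> in \<open>t P\<close> are the
  lattice points of the cone generated by the integral vectors \<open>(p v, p)\<close>, so Gordan's
  lemma and the Hilbert--Serre theorem apply.\<close>

lemma finsupp_diffs_cone_over:
  assumes "distinct vs" "set vs = W"
  shows "finsupp (diffs (map (\<lambda>v. (V v, int p)) vs) (\<lambda>(y, t). of_bool (0 \<le> t \<and> rvec y \<in> dilate (nat t) P)))"
proof -
  let ?us = "map (\<lambda>v. (V v, int p)) vs"
  define \<rho> :: "(int ^ 'd) \<times> int \<Rightarrow> (real ^ 'd) \<times> real" where "\<rho> z = (rvec (fst z), of_int (snd z))" for z
  have add: "\<rho> (x + y) = \<rho> x + \<rho> y" for x y by (simp add: \<rho>_def rvec_add)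
  have fin: "finite {z. norm (\<rho> z) \<le> R}" for R
  proof (rule finite_subset)
    show "{z. norm (\<rho> z) \<le> R} \<subseteq> {y. norm (rvec y) \<le> R} \<times> {- \<lceil>R\<rceil>..\<lceil>R\<rceil>}"
    proof clarify
      fix y t assume "norm (\<rho> (y, t)) \<le> R"
      then have "norm (rvec y) \<le> R" "\<bar>real_of_int t\<bar> \<le> R"
        using norm_fst_le[of "rvec y" "real_of_int t"] norm_snd_le[of "real_of_int t" "rvec y"]
        by (auto simp: \<rho>_def)
      then show "y \<in> {y. norm (rvec y) \<le> R} \<and> t \<in> {- \<lceil>R\<rceil>..\<lceil>R\<rceil>}"
        by (smt (verit) atLeastAtMost_iff le_of_int_ceiling mem_Collect_eq of_int_le_iff of_int_minus)
    qed
  qed (simp add: finite_rvec_bounded)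
  have inj: "inj_on (\<lambda>v. (V v, int p)) W" by (auto simp: inj_on_def V_eq_iff)
  then have dist: "distinct ?us" using assms by (simp add: distinct_map)
  have sums: "(\<Sum>u\<in>set ?us. c u *\<^sub>R \<rho> u)
      = ((\<Sum>v\<in>W. (c (V v, int p) * of_nat p) *\<^sub>R v), (\<Sum>v\<in>W. c (V v, int p) * of_nat p))" for c
  proof -
    have "(\<Sum>u\<in>set ?us. c u *\<^sub>R \<rho> u) = (\<Sum>v\<in>W. c (V v, int p) *\<^sub>R \<rho> (V v, int p))"
      using inj assms(2) by (simp add: sum.reindex)
    also have "\<dots> = (\<Sum>v\<in>W. ((c (V v, int p) * of_nat p) *\<^sub>R v, c (V v, int p) * of_nat p))"
      by (intro sum.cong) (auto simp: \<rho>_def rvec_V)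
    finally show ?thesis by (simp add: sum_prod)
  qed
  have "(\<exists>c. (\<forall>u. 0 \<le> c u) \<and> \<rho> (y, t) = (\<Sum>u\<in>set ?us. c u *\<^sub>R \<rho> u))
      \<longleftrightarrow> 0 \<le> t \<and> rvec y \<in> dilate (nat t) P" (is "?L \<longleftrightarrow> ?R") for y t
  proof
    assume ?L
    then obtain c where c: "\<And>u. 0 \<le> c u" "rvec y = (\<Sum>v\<in>W. (c (V v, int p) * of_nat p) *\<^sub>R v)"
      "of_int t = (\<Sum>v\<in>W. c (V v, int p) * of_nat p)"
      unfolding sums by (auto simp: \<rho>_def)
    have "real_of_int t \<ge> 0" unfolding c(3) by (intro sum_nonneg) (simp add: c(1))
    then have t: "0 \<le> t" by simp
    moreover have "rvec y \<in> dilate (nat t) P"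
    proof (cases "t = 0")
      case True
      then have "(\<Sum>v\<in>W. c (V v, int p) * of_nat p) = 0" using c(3) by simp
      then have "\<forall>v\<in>W. c (V v, int p) * of_nat p = 0"
        using finite_W c(1) by (subst (asm) sum_nonneg_eq_0_iff) auto
      then have "rvec y = 0" unfolding c(2) by (intro sum.neutral) auto
      then show ?thesis using True dilate_0 by simp
    next
      case False
      then have pos: "real_of_int t > 0" using t by simp
      have "(1 / real_of_int t) *\<^sub>R rvec y = (\<Sum>v\<in>W. (c (V v, int p) * of_nat p / of_int t) *\<^sub>R v)"
        unfolding c(2) scaleR_sum_right by (intro sum.cong) auto
      also have "\<dots> \<in> convex hull W"
      proof (rule convex_sum)
        show "(\<Sum>v\<in>W. c (V v, int p) * of_nat p / of_int t) = 1"
          using pos by (simp flip: sum_divide_distrib c(3))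
      qed (use finite_W c(1) pos in \<open>auto intro: hull_inc\<close>)
      finally show ?thesis using False t by (simp add: dilate_iff flip: P_eq)
    qed
    ultimately show ?R ..
  next
    assume R: ?R
    then obtain x where x: "x \<in> P" "rvec y = of_int t *\<^sub>R x" by (auto simp: dilate_def)
    have "x \<in> convex hull W" using x(1) P_eq by simp
    then obtain a where a: "\<And>v. v \<in> W \<Longrightarrow> 0 \<le> a v" "sum a W = 1" "(\<Sum>v\<in>W. a v *\<^sub>R v) = x"
      by (auto simp: convex_hull_finite[OF finite_W])
    \<comment> \<open>The convex weights are scaled by \<open>t / p\<close>, as each generator has
      height \<open>p\<close>; the value zero elsewhere makes \<open>c\<close> nonnegative
      everywhere.\<close>
    define c where "c u = (if u \<in> set ?us then of_int t * a (the_inv_into W (\<lambda>v. (V v, int p)) u) / of_nat p else 0)" for u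
    have c: "c (V v, int p) * of_nat p = of_int t * a v" if "v \<in> W" for v
      using that assms(2) p_pos the_inv_into_f_f[OF inj that] by (auto simp: c_def)
    have "0 \<le> c u" for u
    proof (cases "u \<in> set ?us")
      case True
      then obtain v where "v \<in> W" "u = (V v, int p)" using assms(2) by auto
      then show ?thesis using R a(1)[of v] the_inv_into_f_f[OF inj, of v] by (auto simp: c_def)
    qed (simp only: c_def if_False)
    moreover have "(\<Sum>v\<in>W. (c (V v, int p) * of_nat p) *\<^sub>R v) = of_int t *\<^sub>R (\<Sum>v\<in>W. a v *\<^sub>R v)"
      unfolding scaleR_sum_right by (intro sum.cong) (auto simp: c)
    moreover have "(\<Sum>v\<in>W. c (V v, int p) * of_nat p) = of_int t * sum a W"
      unfolding sum_distrib_left by (intro sum.cong) (auto simp: c)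
    ultimately show ?L
      unfolding sums using a x(2) by (intro exI[of _ c]) (simp add: \<rho>_def)
  qed
  note iff = this
  have M: "{z. \<exists>c. (\<forall>u. 0 \<le> c u) \<and> \<rho> z = (\<Sum>u\<in>set ?us. c u *\<^sub>R \<rho> u)}
      = {(y, t). 0 \<le> t \<and> rvec y \<in> dilate (nat t) P}" (is "?A = ?B")
  proof (rule set_eqI)
    fix z
    show "z \<in> ?A \<longleftrightarrow> z \<in> ?B" using iff[of "fst z" "snd z"] by (simp only: mem_Collect_eq case_prod_beta prod.collapse)
  qed
  note lattice_cone_gspan[of \<rho>, OF add fin dist]
  then have "\<exists>B. finite B \<and> {(y, t). 0 \<le> t \<and> rvec y \<in> dilate (nat t) P} = gspan ?us B"
    by (simp only: M)
  then obtain B where B: "finite B" "{(y, t). 0 \<le> t \<and> rvec y \<in> dilate (nat t) P} = gspan ?us B"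
    by (elim exE conjE)
  have eq: "(\<lambda>(y, t). of_bool (0 \<le> t \<and> rvec y \<in> dilate (nat t) P)) = (\<lambda>z. of_bool (z \<in> gspan ?us B))"
    unfolding B(2)[symmetric] by (rule ext) (simp add: case_prod_beta)
  show ?thesis unfolding eq by (rule finsupp_diffs_gspan[OF B(1)])
qed

text \<open>The differences of the cone over \<open>P\<close> vanish outside a finite set. Once
  \<open>c\<close> exceeds all heights in this set, the recurrence holds without exception.\<close>

lemma recur_indP:
  assumes "distinct vs" "set vs = W"
  shows "\<exists>c0. \<forall>c\<ge>c0. recur (map V vs) (\<lambda>k. indP (k * p + c)) = (\<lambda>k y. 0)"
proof -
  define F :: "(int ^ 'd) \<times> int \<Rightarrow> int" where
    "F = (\<lambda>(y, t). of_bool (0 \<le> t \<and> rvec y \<in> dilate (nat t) P))"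
  let ?D = "diffs (map (\<lambda>v. (v, int p)) (map V vs)) F"
  have "finsupp ?D"
    using finsupp_diffs_cone_over[OF assms] by (simp add: F_def comp_def)
  then have "finite (snd ` {z. ?D z \<noteq> 0})" by (simp add: finsupp_def)
  from bdd_above_finite[OF this] obtain T where T: "\<And>t. t \<in> snd ` {z. ?D z \<noteq> 0} \<Longrightarrow> t \<le> T"
    unfolding bdd_above_def by blast
  have "recur (map V vs) (\<lambda>k. indP (k * p + c)) k y = 0" if "nat T + 1 \<le> c" for c k y
  proof -
    have "(\<lambda>k. indP (k * p + c)) = (\<lambda>k y. F (y, int k * int p + int c))"
      by (intro ext) (simp add: indP_def F_def nat_add_distrib nat_mult_distrib)
    then have "recur (map V vs) (\<lambda>k. indP (k * p + c)) k y
        = ?D (y, (int k + int (length (map V vs))) * int p + int c)"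
      by (simp only: recur_eq_diffs)
    moreover have "(int k + int (length (map V vs))) * int p + int c > T"
    proof -
      have "0 \<le> (int k + int (length (map V vs))) * int p" by simp
      then show ?thesis using that by linarith
    qed
    ultimately show ?thesis using T by (force simp: image_iff)
  qed
  then show ?thesis by blast
qed

text \<open>Seen from the vertex \<open>k p v\<close>, the growing dilates fill the tangent cone:
  with \<open>x = z - c v\<close>, the translated point lies in the dilate iff
  \<open>v + x / (k p + c)\<close> lies in \<open>P\<close>.\<close>

lemma eventually_indP:
  assumes "v \<in> W"
  shows "eventually (\<lambda>k. indP (k * p + c) (z + nmul k (V v)) = indT v c z) sequentially"
proof -
  define x where "x = rvec z - of_nat c *\<^sub>R v"
  have iff: "rvec (z + nmul k (V v)) \<in> dilate (k * p + c) P
      \<longleftrightarrow> v + (1 / of_nat (k * p + c)) *\<^sub>R x \<in> P" if "0 < k" for k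
  proof -
    have "rvec (z + nmul k (V v)) = of_nat (k * p + c) *\<^sub>R v + x"
      by (simp add: x_def rvec_add rvec_nmul rvec_V[OF assms] algebra_simps)
    then show ?thesis using that p_pos
      by (simp add: dilate_iff scaleR_right_distrib del: of_nat_add of_nat_mult)
  qed
  show ?thesis
  proof (cases "x \<in> C v")
    case True
    then obtain s a where sa: "x = s *\<^sub>R (a - v)" "0 \<le> s" "a \<in> P" by (auto simp: C_eq[OF assms])
    \<comment> \<open>For \<open>k\<close> at least \<open>s\<close>, the point in question lies on
      the segment from \<open>v\<close> to \<open>a\<close>; \<open>k\<close> at least 1 keeps the
      dilation factor positive.\<close>
    have "eventually (\<lambda>k. max 1 (nat \<lceil>s\<rceil>) \<le> k) sequentially" by (rule eventually_ge_at_top)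
    then show ?thesis
    proof eventually_elim
      case (elim k)
      define t where "t = real (k * p + c)"
      have "k * 1 \<le> k * p" using p_pos by (intro mult_left_mono) auto
      then have "nat \<lceil>s\<rceil> \<le> k * p + c" using elim by linarith
      then have t: "s \<le> t" unfolding t_def by linarith
      have "0 < k * p + c" using elim p_pos by simp
      then have "0 < t" unfolding t_def by linarith
      with t sa(2) have q: "0 \<le> s / t" "s / t \<le> 1" by auto
      have "v + (1 / t) *\<^sub>R x = v + (s / t) *\<^sub>R (a - v)" by (simp add: sa(1))
      also have "\<dots> = (1 - s / t) *\<^sub>R v + (s / t) *\<^sub>R a" by (simp add: algebra_simps)
      also have "\<dots> \<in> P" using convexD_alt[OF convex_P W_subset[OF assms] sa(3) q] by simp
      finally show ?case using iff[of k] elim True by (simp add: indP_def indT_def x_def t_def)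
    qed
  next
    case False
    have "eventually (\<lambda>k. 1 \<le> k) sequentially" by (rule eventually_ge_at_top)
    then show ?thesis
    proof eventually_elim
      case (elim k)
      define t where "t = real (k * p + c)"
      have "0 < k * p + c" using elim p_pos by simp
      then have "0 < t" unfolding t_def by linarith
      have "v + (1 / t) *\<^sub>R x \<notin> P"
      proof
        assume "v + (1 / t) *\<^sub>R x \<in> P"
        moreover have "x = t *\<^sub>R ((v + (1 / t) *\<^sub>R x) - v)" using \<open>0 < t\<close> by simp
        ultimately have "x \<in> C v" using \<open>0 < t\<close> unfolding C_eq[OF assms] by fastforce
        with False show False ..
      qed
      then show ?case using iff[of k] elim False by (simp add: indP_def indT_def x_def t_def)
    qed
  qed
qed

lemma indT_shift: "v \<in> W \<Longrightarrow> indT v (k * p + c) y = indT v c (y - nmul k (V v))"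
  by (simp add: indT_def rvec_diff rvec_nmul rvec_V algebra_simps)

end

section \<open>Brion's identity up to torsion\<close>

context rational_polytope_data
begin

text \<open>Following the vertex \<open>k p v\<close> as \<open>k\<close> grows pushes the summands
  of all other vertices out of their finite supports, while the left side stabilises to the tangent
  cone. So \<open>g (V v)\<close> is \<open>diffs ws\<close> of the indicator of that cone, for
  every \<open>v\<close>.\<close>

lemma brion_error_torsion_large:
  assumes "distinct vs" "set vs = W" "recur (map V vs) (\<lambda>k. indP (k * p + c)) = (\<lambda>k y. 0)"
  shows "\<exists>ws. 0 \<notin> set ws \<and> (\<forall>k. diffs ws (brion_error (k * p + c)) = (\<lambda>_. 0))"
proof -
  have "distinct (map V vs)" using assms(1,2) by (auto simp: distinct_map inj_on_def V_eq_iff)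
  from recur_solution[OF this finsupp_indP assms(3)]
  obtain ws g where ws: "0 \<notin> set ws" and g: "\<forall>v\<in>set (map V vs). finsupp (g v)"
    and eq: "\<forall>k y. diffs ws (indP (k * p + c)) y = (\<Sum>v\<in>set (map V vs). g v (y - nmul k v))"
    by (elim exE conjE)
  have inj: "inj_on V W" by (auto simp: inj_on_def V_eq_iff)
  have g: "finsupp (g (V v))" if "v \<in> W" for v using g that assms(2) by auto
  have eq: "diffs ws (indP (k * p + c)) y = (\<Sum>v\<in>W. g (V v) (y - nmul k (V v)))" for k y
    using eq inj assms(2) by (simp add: sum.reindex)
  have gT: "g (V v) y = diffs ws (indT v c) y" if v: "v \<in> W" for v y
  proof -
    have "eventually (\<lambda>k. diffs ws (\<lambda>z. indP (k * p + c) (z + nmul k (V v))) y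
        = diffs ws (indT v c) y) sequentially"
      by (rule diffs_eventually) (rule eventually_indP[OF v])
    moreover have "diffs ws (\<lambda>z. indP (k * p + c) (z + nmul k (V v))) y
        = (\<Sum>w\<in>W. g (V w) (y + nmul k (V v) - nmul k (V w)))" for k
      using diffs_shift[of ws "indP (k * p + c)" "- nmul k (V v)"] by (simp add: eq)
    ultimately have e1: "eventually (\<lambda>k. (\<Sum>w\<in>W. g (V w) (y + nmul k (V v) - nmul k (V w)))
        = diffs ws (indT v c) y) sequentially" by simp
    have "eventually (\<lambda>k. g (V w) (y + nmul k (V v) - nmul k (V w)) = (if w = v then g (V v) y else 0))
        sequentially" if w: "w \<in> W" for w
    proof (cases "w = v")
      case False
      then have "V v \<noteq> V w" using v w by (simp add: V_eq_iff)
      then obtain i where i: "V v $ i \<noteq> V w $ i" by (auto simp: vec_eq_iff)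
      \<comment> \<open>The argument runs injectively through the lattice, so it meets a finite
        support only finitely often.\<close>
      define e where "e k = y + nmul k (V v) - nmul k (V w)" for k
      have "inj e"
      proof (rule injI)
        fix j k assume jk: "e j = e k"
        have "e m $ i = y $ i + int m * (V v $ i - V w $ i)" for m
          by (simp add: e_def nmul_component algebra_simps)
        with arg_cong[OF jk, of "\<lambda>x. x $ i"] i show "j = k" by simp
      qed
      then have "finite (e -` {x. g (V w) x \<noteq> 0})"
        using g[OF w] by (intro finite_vimageI) (auto simp: finsupp_def)
      then have "finite {k. g (V w) (e k) \<noteq> 0}" by (simp add: vimage_def)
      then have "eventually (\<lambda>k. \<not> g (V w) (e k) \<noteq> 0) cofinite"
        by (simp add: eventually_cofinite)
      then show ?thesis using False by (simp add: e_def cofinite_eq_sequentially)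
    qed simp
    then have "eventually (\<lambda>k. \<forall>w\<in>W. g (V w) (y + nmul k (V v) - nmul k (V w))
        = (if w = v then g (V v) y else 0)) sequentially"
      using finite_W by (simp add: eventually_ball_finite)
    with e1 have "eventually (\<lambda>k. g (V v) y = diffs ws (indT v c) y) sequentially"
    proof eventually_elim
      case (elim k)
      have "(\<Sum>w\<in>W. g (V w) (y + nmul k (V v) - nmul k (V w))) = (\<Sum>w\<in>W. if w = v then g (V v) y else 0)"
        by (rule sum.cong) (use elim(2) in blast)+
      then show ?case using elim(1) v finite_W by simp
    qed
    then show ?thesis by simp
  qed
  have "diffs ws (brion_error (k * p + c)) y = 0" for k y
  proof -
    have "brion_error (k * p + c) = (\<lambda>y. indP (k * p + c) y - (\<Sum>v\<in>W. indT v c (y - nmul k (V v))))"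
      by (rule ext) (simp add: brion_error_def indT_shift)
    then have "diffs ws (brion_error (k * p + c)) y
        = diffs ws (indP (k * p + c)) y - (\<Sum>v\<in>W. diffs ws (indT v c) (y - nmul k (V v)))"
      by (simp only: diffs_minus diffs_sum diffs_shift)
    then show ?thesis by (simp add: eq gT)
  qed
  then show ?thesis using ws by blast
qed

lemma brion_error_scale: "0 < N \<Longrightarrow> 0 < t \<Longrightarrow> brion_error (N * t) (nmul N y) = brion_error t y"
proof -
  assume N: "0 < N" "0 < t"
  have "indP (N * t) (nmul N y) = indP t y"
    using N by (simp add: indP_def dilate_iff rvec_nmul)
  moreover have "indT v (N * t) (nmul N y) = indT v t y" for v
    using N C_scale[of "of_nat N" "rvec y - of_nat t *\<^sub>R v" v]
    by (simp add: indT_def rvec_nmul scaleR_diff_right)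
  ultimately show ?thesis by (simp add: brion_error_def)
qed

text \<open>Torsion survives restriction to a coset of a sublattice: \<open>1 - x^u\<close> divides
  \<open>1 - x^(N u)\<close>.\<close>

lemma diffs_affine_nmul_zero:
  assumes "diffs ws f = (\<lambda>_. 0)"
  shows "diffs ws (\<lambda>z. f (nmul N z + a)) y = 0"
proof -
  have "diffs ws (\<lambda>z. f (nmul N z + a)) y = diffs (map (nmul N) ws) f (nmul N y + a)"
    by (rule diffs_affine[symmetric]) (rule nmul_diff)
  then show ?thesis by (simp add: diffs_nmul assms avg_zero)
qed

text \<open>\<open>N z + p v\<close> lies in \<open>p P\<close> iff \<open>v + (N / p) z\<close>
  lies in \<open>P\<close>; as \<open>P\<close> is bounded, only \<open>z = 0\<close> satisfies this
  for large \<open>N\<close>.\<close>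

lemma eventually_indP_contract:
  assumes "v \<in> W"
  shows "eventually (\<lambda>N. indP p (nmul N z + V v) = indP 0 z) sequentially"
proof -
  have iff: "rvec (nmul N z + V v) \<in> dilate p P \<longleftrightarrow> v + (of_nat N / of_nat p) *\<^sub>R rvec z \<in> P" for N
    using p_pos by (simp add: dilate_iff rvec_add rvec_nmul rvec_V[OF assms] scaleR_right_distrib add.commute)
  show ?thesis
  proof (cases "z = 0")
    case True
    then show ?thesis unfolding indP_def iff
      using W_subset[OF assms] by (simp add: dilate_0 rvec_0)
  next
    case False
    then have z: "norm (rvec z) > 0" using rvec_eq_iff[of z 0] by (simp add: rvec_0)
    obtain R where R: "\<And>x. x \<in> P \<Longrightarrow> norm x \<le> R" using bounded_P by (auto simp: bounded_iff)
    define M where "M = nat \<lceil>(R + norm v) * of_nat p / norm (rvec z)\<rceil> + 1"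
    have "eventually (\<lambda>N. M \<le> N) sequentially" by (rule eventually_ge_at_top)
    then show ?thesis
    proof eventually_elim
      case (elim N)
      then have "(R + norm v) * of_nat p / norm (rvec z) < of_nat N" unfolding M_def by linarith
      then have big: "R + norm v < (of_nat N / of_nat p) * norm (rvec z)"
        using z p_pos by (simp add: field_simps)
      have "v + (of_nat N / of_nat p) *\<^sub>R rvec z \<notin> P"
      proof
        assume "v + (of_nat N / of_nat p) *\<^sub>R rvec z \<in> P"
        then have "norm (v + (of_nat N / of_nat p) *\<^sub>R rvec z) \<le> R" by (rule R)
        moreover have "norm ((of_nat N / of_nat p) *\<^sub>R rvec z)
            \<le> norm (v + (of_nat N / of_nat p) *\<^sub>R rvec z) + norm v"
          using norm_triangle_ineq4[of "v + (of_nat N / of_nat p) *\<^sub>R rvec z" v] by simp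
        ultimately show False using big by simp
      qed
      then show ?case using z by (auto simp: indP_def iff dilate_0)
    qed
  qed
qed

text \<open>The condition reads \<open>z + (p / N) (v - w)\<close> in \<open>C w\<close>. It holds
  for \<open>z\<close> in \<open>C w\<close> because \<open>v - w\<close> is in \<open>C w\<close>,
  and it fails for other \<open>z\<close> and large \<open>N\<close> because the complement of
  \<open>C w\<close> is open.\<close>

lemma eventually_indT_contract:
  assumes "v \<in> W" "w \<in> W"
  shows "eventually (\<lambda>N. indT w p (nmul N z + V v) = indT w 0 z) sequentially"
proof -
  have vw: "v - w \<in> C w" unfolding C_def using assms(1) by (intro hull_inc image_eqI[of _ _ v]) simp_all
  have iff: "rvec (nmul N z + V v) - of_nat p *\<^sub>R w \<in> C w
      \<longleftrightarrow> rvec z + (of_nat p / of_nat N) *\<^sub>R (v - w) \<in> C w" if "0 < N" for N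
  proof -
    have "rvec (nmul N z + V v) - of_nat p *\<^sub>R w
        = of_nat N *\<^sub>R (rvec z + (of_nat p / of_nat N) *\<^sub>R (v - w))"
      using that by (simp add: rvec_add rvec_nmul rvec_V[OF assms(1)] scaleR_right_distrib scaleR_diff_right)
    then show ?thesis using that by (simp only: C_scale of_nat_0_less_iff)
  qed
  show ?thesis
  proof (cases "rvec z \<in> C w")
    case True
    have "eventually (\<lambda>N. 0 < N) sequentially" by (rule eventually_gt_at_top)
    then show ?thesis
    proof eventually_elim
      case (elim N)
      have "(of_nat p / of_nat N) *\<^sub>R (v - w) \<in> C w"
        using vw unfolding C_def by (intro convex_cone_hull_mul) auto
      then show ?case using True iff[OF elim] by (simp add: indT_def C_add)
    qed
  next
    case False
    have "(\<lambda>N. rvec z + (of_nat p / of_nat N) *\<^sub>R (v - w)) \<longlonglongrightarrow> rvec z + 0 *\<^sub>R (v - w)"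
      by (intro tendsto_intros lim_const_over_n)
    then have "eventually (\<lambda>N. rvec z + (of_nat p / of_nat N) *\<^sub>R (v - w) \<in> - C w) sequentially"
      using closed_C False by (intro topological_tendstoD) auto
    with eventually_gt_at_top[of 0] show ?thesis
      by eventually_elim (use False iff in \<open>auto simp: indT_def\<close>)
  qed
qed

text \<open>Large dilates are treated first; a small positive \<open>t\<close> is reached by replacing \<open>t\<close> with a multiple
  \<open>N t\<close> in the same residue class. For \<open>t = 0\<close>, \<open>P\<close> is shrunk towards one of its vertices and the
  closedness of the tangent cones is used in the limit.\<close>

lemma brion_error_torsion:
  "\<exists>ws. 0 \<notin> set ws \<and> (\<forall>k. diffs ws (brion_error (k * p + r)) = (\<lambda>_. 0))"
proof -
  obtain vs where vs: "distinct vs" "set vs = W" using finite_distinct_list[OF finite_W] by blast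
  from recur_indP[OF vs] obtain c0
    where c0: "\<forall>c\<ge>c0. recur (map V vs) (\<lambda>k. indP (k * p + c)) = (\<lambda>k y. 0)" by (elim exE)
  \<comment> \<open>The offset \<open>c0 p + r\<close> is large enough for the recurrence and lies
    in the residue class of \<open>r\<close>.\<close>
  have "c0 * 1 \<le> c0 * p" using p_pos by (intro mult_left_mono) auto
  then have "c0 \<le> c0 * p + r" by linarith
  from brion_error_torsion_large[OF vs c0[rule_format, OF this]]
  obtain ws where ws: "0 \<notin> set ws"
    and "\<forall>k. diffs ws (brion_error (k * p + (c0 * p + r))) = (\<lambda>_. 0)" by (elim exE conjE)
  note large = this(2)[rule_format]
  have pos: "diffs ws (brion_error (k * p + r)) = (\<lambda>_. 0)" if "0 < k * p + r" for k
  proof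
    fix y
    define t where "t = k * p + r"
    \<comment> \<open>\<open>N\<close> is 1 modulo \<open>p\<close>, so \<open>N t\<close> stays in
      the residue class, and since \<open>t\<close> is positive, \<open>N t\<close> reaches the
      range already treated.\<close>
    define N where "N = 1 + p * c0"
    have t: "0 < t" using that by (simp add: t_def)
    then obtain d where d: "c0 * t = c0 + d" using le_Suc_ex[of c0 "c0 * t"] by auto
    have "N * t = t + p * (c0 * t)" by (simp add: N_def algebra_simps)
    also have "\<dots> = (k + d) * p + (c0 * p + r)" unfolding d by (simp add: t_def algebra_simps)
    finally have "diffs ws (brion_error (N * t)) = (\<lambda>_. 0)" by (simp only: large)
    from diffs_affine_nmul_zero[OF this, of N 0 y]
    have "diffs ws (\<lambda>z. brion_error (N * t) (nmul N z)) y = 0" by simp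
    moreover have "(\<lambda>z. brion_error (N * t) (nmul N z)) = brion_error t"
      by (rule ext, rule brion_error_scale) (simp_all add: N_def t)
    ultimately show "diffs ws (brion_error (k * p + r)) y = 0" by (simp only: t_def)
  qed
  have "diffs ws (brion_error (k * p + r)) = (\<lambda>_. 0)" for k
  proof (cases "k * p + r = 0")
    case True
    then have r: "r = 0" by simp
    obtain v where v: "v \<in> W" using W_nonempty by auto
    have zero: "diffs ws (brion_error p) = (\<lambda>_. 0)" using pos[of 1] p_pos by (simp add: r)
    have "eventually (\<lambda>N. brion_error p (nmul N z + V v) = brion_error 0 z) sequentially" for z
    proof -
      have "eventually (\<lambda>N. \<forall>w\<in>W. indT w p (nmul N z + V v) = indT w 0 z) sequentially"
        using finite_W eventually_indT_contract[OF v] by (simp add: eventually_ball_finite)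
      with eventually_indP_contract[OF v, of z] show ?thesis
        by eventually_elim (simp add: brion_error_def)
    qed
    from diffs_eventually[OF this]
    have "eventually (\<lambda>N. diffs ws (\<lambda>z. brion_error p (nmul N z + V v)) y = diffs ws (brion_error 0) y)
        sequentially" for y .
    then have "eventually (\<lambda>N::nat. 0 = diffs ws (brion_error 0) y) sequentially" for y
      by (simp add: diffs_affine_nmul_zero[OF zero])
    then have "diffs ws (brion_error 0) = (\<lambda>_. 0)" by (intro ext) simp
    then show ?thesis by (simp only: True)
  next
    case False
    then show ?thesis by (intro pos) simp
  qed
  with ws show ?thesis by blast
qed

end

section \<open>Primitive edge directions and numerators of tangent cones\<close>

lemma primitive_vec_scale:
  assumes "u \<noteq> 0"
  shows "\<exists>g>0. rvec u = of_int g *\<^sub>R rvec (primitive_vec u)"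
proof -
  define g where "g = Gcd (range (\<lambda>i. u $ i))"
  have "g dvd u $ i" for i unfolding g_def by (rule Gcd_dvd) simp
  then have "u $ i = g * primitive_vec u $ i" for i
    by (simp add: primitive_vec_def g_def)
  then have "rvec u = of_int g *\<^sub>R rvec (primitive_vec u)"
    by (simp add: rvec_def vec_eq_iff)
  moreover have "g \<noteq> 0"
  proof
    assume "g = 0"
    then have "range (\<lambda>i. u $ i) \<subseteq> {0}" by (simp add: g_def)
    then have "u = 0" by (auto simp: vec_eq_iff)
    with assms show False ..
  qed
  moreover have "0 \<le> g" by (simp add: g_def)
  ultimately show ?thesis by (intro exI[of _ g]) simp
qed

lemma convex_cone_hull_rescale:
  assumes "\<And>a. a \<in> A \<Longrightarrow> \<exists>s>0. f a = s *\<^sub>R h a"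
  shows "convex_cone hull (f ` A) = convex_cone hull (h ` A)"
proof
  show "convex_cone hull (f ` A) \<subseteq> convex_cone hull (h ` A)"
  proof (rule hull_minimal)
    show "f ` A \<subseteq> convex_cone hull (h ` A)"
    proof clarify
      fix a assume a: "a \<in> A"
      then obtain s where s: "0 < s" "f a = s *\<^sub>R h a" using assms by blast
      have "h a \<in> convex_cone hull (h ` A)" using a by (intro hull_inc imageI)
      then show "f a \<in> convex_cone hull (h ` A)"
        unfolding s(2) using s(1) by (intro convex_cone_hull_mul) auto
    qed
  qed (rule convex_cone_convex_cone_hull)
  show "convex_cone hull (h ` A) \<subseteq> convex_cone hull (f ` A)"
  proof (rule hull_minimal)
    show "h ` A \<subseteq> convex_cone hull (f ` A)"
    proof clarify
      fix a assume a: "a \<in> A"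
      then obtain s where s: "0 < s" "f a = s *\<^sub>R h a" using assms by blast
      then have h: "h a = (1 / s) *\<^sub>R f a" by simp
      have "f a \<in> convex_cone hull (f ` A)" using a by (intro hull_inc imageI)
      then show "h a \<in> convex_cone hull (f ` A)"
        unfolding h using s(1) by (intro convex_cone_hull_mul) auto
    qed
  qed (rule convex_cone_convex_cone_hull)
qed

lemma finsupp_bdd_below: "finsupp f \<Longrightarrow> \<exists>K. \<forall>y. f y \<noteq> 0 \<longrightarrow> K \<le> (lam y :: int)"
proof -
  assume "finsupp f"
  then have "bdd_below (lam ` {y. f y \<noteq> 0})"
    by (intro bdd_below_finite finite_imageI) (simp add: finsupp_def)
  then show ?thesis by (auto simp: bdd_below_def)
qed

text \<open>Since \<open>lam u\<close> is negative, \<open>y - u\<close> lies above level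
  \<open>m\<close>, where \<open>f\<close> vanishes. So no difference changes the values at level
  \<open>m\<close> or higher.\<close>

lemma diffs_top:
  fixes lam :: "'a::ab_group_add \<Rightarrow> int"
  assumes "\<And>x y. lam (x - y) = lam x - lam y" "\<And>u. u \<in> set us \<Longrightarrow> lam u < 0"
    and "\<And>y. m < lam y \<Longrightarrow> f y = 0" "m \<le> lam y"
  shows "diffs us f y = f y"
  using assms(2-4)
proof (induction us arbitrary: f)
  case (Cons u us)
  have step: "diff1 u f x = f x" if "m \<le> lam x" for x
  proof -
    have "m < lam (x - u)" using that Cons.prems(1)[of u] assms(1) by simp
    then show ?thesis using Cons.prems(2) by (simp add: diff1_def)
  qed
  have "diffs us (diff1 u f) y = diff1 u f y"
    using Cons.prems step by (intro Cons.IH) auto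
  then show ?case using step Cons.prems(3) by simp
qed simp

context rational_polytope_data
begin

definition edge_dirs :: "real ^ 'd \<Rightarrow> (int ^ 'd) set" where
  "edge_dirs v = (\<lambda>w. primitive_vec (V w - V v)) ` {w. adjacent P v w}"

text \<open>A fixed enumeration without repetition, as \<open>diffs\<close> and the products of edge
  factors are taken over lists.\<close>

definition edge_list :: "real ^ 'd \<Rightarrow> (int ^ 'd) list" where
  "edge_list v = (SOME us. distinct us \<and> set us = edge_dirs v)"

lemma adjacent_W: "adjacent P v w \<Longrightarrow> v \<in> W \<and> w \<in> W"
  by (simp add: adjacent_def)

lemma edge_list: "distinct (edge_list v)" "set (edge_list v) = edge_dirs v"
proof -
  have "{w. adjacent P v w} \<subseteq> W" using adjacent_W by auto
  then have "finite (edge_dirs v)"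
    unfolding edge_dirs_def using finite_W finite_subset by (intro finite_imageI) blast
  from finite_distinct_list[OF this] have "\<exists>us. distinct us \<and> set us = edge_dirs v" by auto
  from someI_ex[OF this] show "distinct (edge_list v)" "set (edge_list v) = edge_dirs v"
    by (simp_all add: edge_list_def)
qed

lemma rvec_edge: "adjacent P v w \<Longrightarrow> rvec (V w - V v) = of_nat p *\<^sub>R (w - v)"
  using adjacent_W[of v w] by (simp add: rvec_diff rvec_V scaleR_diff_right)

lemma primitive_edge:
  assumes "adjacent P v w"
  shows "\<exists>s>0. rvec (primitive_vec (V w - V v)) = s *\<^sub>R (w - v)"
proof -
  have "V w - V v \<noteq> 0" using adjacent_neq[OF assms] adjacent_W[OF assms] by (simp add: V_eq_iff)
  then obtain g where g: "0 < g" "rvec (V w - V v) = of_int g *\<^sub>R rvec (primitive_vec (V w - V v))"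
    using primitive_vec_scale by blast
  then have "rvec (primitive_vec (V w - V v)) = (1 / of_int g) *\<^sub>R rvec (V w - V v)" by simp
  also have "\<dots> = (of_nat p / of_int g) *\<^sub>R (w - v)" by (simp add: rvec_edge[OF assms])
  finally show ?thesis using g(1) p_pos by (intro exI[of _ "of_nat p / of_int g"]) simp
qed

lemma C_eq_edges:
  assumes "v \<in> W"
  shows "C v = convex_cone hull (rvec ` nmul p ` edge_dirs v)"
proof -
  have "\<exists>s>0. rvec (nmul p (primitive_vec (V w - V v))) = s *\<^sub>R (w - v)"
    if "w \<in> {w. adjacent P v w}" for w
  proof -
    from that obtain s where s: "0 < s" "rvec (primitive_vec (V w - V v)) = s *\<^sub>R (w - v)"
      using primitive_edge by blast
    then show ?thesis using p_pos by (intro exI[of _ "of_nat p * s"]) (simp add: rvec_nmul)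
  qed
  from convex_cone_hull_rescale[of "{w. adjacent P v w}" "\<lambda>w. rvec (nmul p (primitive_vec (V w - V v)))"
      "\<lambda>w. w - v", OF this]
  have "convex_cone hull (rvec ` nmul p ` edge_dirs v) = convex_cone hull ((\<lambda>w. w - v) ` {w. adjacent P v w})"
    by (simp add: edge_dirs_def image_image)
  moreover have "C v = convex_cone hull ((\<lambda>w. w - v) ` {w. adjacent P v w})"
    unfolding C_def by (rule tangent_cone_edges[OF P_eq refl assms finite_W])
  ultimately show ?thesis by (simp only:)
qed

text \<open>The numerator of the generating function of \<open>C v\<close> for the
  \<open>p\<close>-fold edge directions. The apex \<open>t v\<close> need not be integral;
  multiplication by \<open>p\<close> moves it to the lattice point \<open>t (p v)\<close> and turns
  differences by \<open>u\<close> into differences by \<open>p u\<close>.\<close>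

definition cone_diffs :: "real ^ 'd \<Rightarrow> int ^ 'd \<Rightarrow> int" where
  "cone_diffs v = diffs (map (nmul p) (edge_list v)) (\<lambda>z. of_bool (rvec z \<in> C v))"

text \<open>The edge directions generate the cone, so Gordan's lemma and the Hilbert--Serre theorem
  apply; the injection \<open>rvec\<close> translates between coefficients on real and on lattice
  generators.\<close>

lemma finsupp_cone_diffs:
  assumes "v \<in> W"
  shows "finsupp (cone_diffs v)"
proof -
  let ?us = "map (nmul p) (edge_list v)"
  have "inj (nmul p :: int ^ 'd \<Rightarrow> int ^ 'd)"
  proof (rule injI)
    fix x y :: "int ^ 'd" assume "nmul p x = nmul p y"
    then have "int p * x $ i = int p * y $ i" for i by (metis nmul_component)
    then show "x = y" using p_pos by (simp add: vec_eq_iff)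
  qed
  then have "inj_on (nmul p) (set (edge_list v))" by (rule inj_on_subset) simp
  then have dist: "distinct ?us" using edge_list(1) by (simp add: distinct_map)
  have set: "set ?us = nmul p ` edge_dirs v" by (simp add: edge_list(2))
  have fin: "finite (rvec ` set ?us)" by simp
  have inj': "inj (rvec :: int ^ 'd \<Rightarrow> _)" by (simp add: inj_def rvec_eq_iff)
  then have inj: "inj_on rvec (set ?us)" by (rule inj_on_subset) simp
  have "(\<exists>c. (\<forall>u. 0 \<le> c u) \<and> rvec z = (\<Sum>u\<in>set ?us. c u *\<^sub>R rvec u)) \<longleftrightarrow> rvec z \<in> C v"
    (is "?L \<longleftrightarrow> ?R") for z
  proof
    assume ?L
    then obtain c where c: "\<And>u. 0 \<le> c u" "rvec z = (\<Sum>u\<in>set ?us. c u *\<^sub>R rvec u)" by auto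
    have "(\<Sum>s\<in>rvec ` set ?us. c (inv rvec s) *\<^sub>R s) = rvec z"
      unfolding c(2) sum.reindex[OF inj] by (simp add: inv_f_f[OF inj'])
    then have "rvec z \<in> convex_cone hull (rvec ` set ?us)"
      unfolding convex_cone_hull_finite[OF fin] using c(1)
      by (intro CollectI exI[of _ "\<lambda>s. c (inv rvec s)"]) simp
    then show ?R unfolding C_eq_edges[OF assms] set .
  next
    assume ?R
    then have "rvec z \<in> convex_cone hull (rvec ` set ?us)" unfolding C_eq_edges[OF assms] set .
    then obtain c where "\<forall>s. 0 \<le> c s" "rvec z = (\<Sum>s\<in>rvec ` set ?us. c s *\<^sub>R s)"
      unfolding convex_cone_hull_finite[OF fin] by blast
    then show ?L
      unfolding sum.reindex[OF inj] by (intro exI[of _ "\<lambda>u. c (rvec u)"]) simp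
  qed
  then have M: "{z. \<exists>c. (\<forall>u. 0 \<le> c u) \<and> rvec z = (\<Sum>u\<in>set ?us. c u *\<^sub>R rvec u)} = {z. rvec z \<in> C v}"
    by (rule Collect_cong)
  note lattice_cone_gspan[of rvec, OF rvec_add finite_rvec_bounded dist]
  then have "\<exists>B. finite B \<and> {z. rvec z \<in> C v} = gspan ?us B" by (simp only: M)
  then obtain B where B: "finite B" "{z. rvec z \<in> C v} = gspan ?us B" by (elim exE conjE)
  have eq: "(\<lambda>z. of_bool (rvec z \<in> C v)) = (\<lambda>z. of_bool (z \<in> gspan ?us B))"
    unfolding B(2)[symmetric] by simp
  show ?thesis unfolding cone_diffs_def eq by (rule finsupp_diffs_gspan[OF B(1)])
qed

lemma diffs_indT:
  assumes "v \<in> W"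
  shows "diffs (edge_list v) (indT v t) y = cone_diffs v (nmul p y - nmul t (V v))"
proof -
  have "indT v t = (\<lambda>z. of_bool (rvec (nmul p z + - nmul t (V v)) \<in> C v))"
  proof
    fix z
    have "rvec (nmul p z + - nmul t (V v)) = of_nat p *\<^sub>R (rvec z - of_nat t *\<^sub>R v)"
      by (simp add: rvec_diff rvec_nmul rvec_V[OF assms] scaleR_diff_right)
    then show "indT v t z = of_bool (rvec (nmul p z + - nmul t (V v)) \<in> C v)"
      using C_scale[of "of_nat p"] p_pos by (simp add: indT_def)
  qed
  then show ?thesis
    using diffs_affine[of "nmul p" "edge_list v" "\<lambda>z. of_bool (rvec z \<in> C v)" y "- nmul t (V v)", OF nmul_diff]
    by (simp add: cone_diffs_def)
qed

lemma finsupp_diffs_indT: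
  assumes "v \<in> W"
  shows "finsupp (diffs (edge_list v) (indT v t))"
proof -
  have "inj (\<lambda>y. nmul p y - nmul t (V v))"
  proof (rule injI)
    fix x y assume "nmul p x - nmul t (V v) = nmul p y - nmul t (V v)"
    then have "nmul p x = nmul p y" by simp
    then have "int p * x $ i = int p * y $ i" for i by (metis nmul_component)
    then show "x = y" using p_pos by (simp add: vec_eq_iff)
  qed
  then have "finite ((\<lambda>y. nmul p y - nmul t (V v)) -` {z. cone_diffs v z \<noteq> 0})"
    using finsupp_cone_diffs[OF assms] by (intro finite_vimageI) (auto simp: finsupp_def)
  then show ?thesis by (simp add: finsupp_def diffs_indT[OF assms] vimage_def)
qed

text \<open>Since the cone is invariant under dilation by \<open>N\<close>, the value at \<open>z\<close> is a sum of values near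
  \<open>N z\<close>, translated by fewer than \<open>N\<close> multiples of each generator. Letting \<open>N\<close> grow turns
  boundedness of the support into the exact lower bound.\<close>

lemma cone_diffs_support:
  assumes "v \<in> W" "cone_diffs v z \<noteq> 0"
  shows "int p * (\<Sum>u\<leftarrow>edge_list v. min 0 (form l u)) \<le> form l z"
proof -
  let ?us = "map (nmul p) (edge_list v)"
  define m where "m = (\<Sum>u\<leftarrow>?us. min 0 (form l u))"
  obtain K where K: "\<And>y. cone_diffs v y \<noteq> 0 \<Longrightarrow> K \<le> form l y"
    using finsupp_bdd_below[OF finsupp_cone_diffs[OF assms(1)], of "form l"] by auto
  have bound: "K + (int N - 1) * m \<le> int N * form l z" if N: "0 < N" for N
  proof -
    have "(\<lambda>y. of_bool (rvec (nmul N y + 0) \<in> C v)) = (\<lambda>y. of_bool (rvec y \<in> C v) :: int)"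
      using N C_scale[of "of_nat N"] by (simp add: rvec_nmul)
    then have "cone_diffs v z = diffs ?us (\<lambda>y. of_bool (rvec (nmul N y + 0) \<in> C v)) z"
      by (simp only: cone_diffs_def)
    also have "\<dots> = diffs (map (nmul N) ?us) (\<lambda>y. of_bool (rvec y \<in> C v)) (nmul N z + 0)"
      using diffs_affine[of "nmul N" ?us "\<lambda>y. of_bool (rvec y \<in> C v)" z 0, OF nmul_diff] by simp
    also have "\<dots> = avg N ?us (cone_diffs v) (nmul N z)"
      by (simp only: diffs_nmul cone_diffs_def add_0_right)
    finally have "avg N ?us (cone_diffs v) (nmul N z) \<noteq> 0" using assms(2) by simp
    from avg_support[of "form l", OF form_diff form_nmul N K this]
    show ?thesis by (simp add: m_def form_nmul)
  qed
  have "m \<le> form l z"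
  proof (rule ccontr)
    assume "\<not> m \<le> form l z"
    then have le: "form l z \<le> m - 1" by simp
    \<comment> \<open>If \<open>form l z\<close> were at most \<open>m - 1\<close>, the bound would
      give \<open>K + N\<close> at most \<open>m\<close>, which this \<open>N\<close>
      violates.\<close>
    define N where "N = nat \<bar>m - K\<bar> + 1"
    have "int N * form l z \<le> int N * (m - 1)" by (rule mult_left_mono[OF le]) simp
    with bound[of N] have "K + (int N - 1) * m \<le> int N * (m - 1)" by (simp add: N_def)
    then have "K + int N \<le> m" by (simp add: algebra_simps)
    then show False by (simp add: N_def)
  qed
  moreover have "min 0 (form l (nmul p u)) = int p * min 0 (form l u)" for u
    using p_pos by (simp add: form_nmul min_def mult_le_0_iff zero_le_mult_iff)
  then have "m = int p * (\<Sum>u\<leftarrow>edge_list v. min 0 (form l u))"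
    by (simp add: m_def comp_def sum_list_const_mult)
  ultimately show ?thesis by simp
qed

text \<open>\<open>us\<close> joins the edge directions of all vertices. For each \<open>v\<close>
  the block \<open>edge_list v\<close> already makes the tangent cone finitely supported, and the
  other differences preserve this. The error is then both finitely supported and torsion.\<close>

lemma brion:
  assumes "distinct vs" "set vs = W" "t = k * p + r"
  defines "us \<equiv> concat (map edge_list vs)"
  shows "diffs us (indP t) y = (\<Sum>v\<in>W. diffs us (indT v t) y)"
    and "v \<in> W \<Longrightarrow> finsupp (diffs us (indT v t))"
proof -
  have split: "\<exists>as bs. us = as @ edge_list v @ bs" if "v \<in> W" for v
  proof -
    have "v \<in> set vs" using that assms(2) by simp
    from split_list[OF this] obtain xs ys where "vs = xs @ v # ys" by (elim exE)
    then show ?thesis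
      by (intro exI[of _ "concat (map edge_list xs)"] exI[of _ "concat (map edge_list ys)"]) (simp add: us_def)
  qed
  have fin: "finsupp (diffs us (indT v t))" if v: "v \<in> W" for v
  proof -
    obtain as bs where us: "us = as @ edge_list v @ bs" using split[OF v] by blast
    have "diffs us (indT v t) = diffs bs (diffs as (diffs (edge_list v) (indT v t)))"
      unfolding us diffs_append by (simp only: diffs_commute)
    then show ?thesis by (simp only: finsupp_diffs finsupp_diffs_indT[OF v])
  qed
  then show "v \<in> W \<Longrightarrow> finsupp (diffs us (indT v t))" .
  have err: "diffs us (brion_error t) = (\<lambda>y. diffs us (indP t) y - (\<Sum>v\<in>W. diffs us (indT v t) y))"
    unfolding brion_error_def[abs_def] by (simp only: diffs_minus diffs_sum)
  have "finsupp (diffs us (brion_error t))"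
    unfolding err by (intro finsupp_minus finsupp_sum finite_W fin finsupp_diffs finsupp_indP)
  moreover obtain ws where ws: "0 \<notin> set ws" "diffs ws (brion_error t) = (\<lambda>_. 0)"
    using brion_error_torsion[of r] assms(3) by blast
  moreover have "diffs ws (diffs us (brion_error t)) = (\<lambda>_. 0)"
    by (subst diffs_commute) (simp only: ws(2) diffs_zero)
  ultimately have "diffs us (brion_error t) = (\<lambda>_. 0)"
    using finsupp_diffs_zero by blast
  then show "diffs us (indP t) y = (\<Sum>v\<in>W. diffs us (indT v t) y)"
    unfolding err by (auto dest: fun_cong[of _ _ y])
qed

end

section \<open>The interpolating polynomial\<close>

lemma regular_at_coeff_mult:
  assumes "\<And>i. regular_at z (coeff f i)" "\<And>i. regular_at z (coeff g i)"
  shows "regular_at z (coeff (f * g) i)"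
  unfolding coeff_mult using assms by (intro regular_at_sum regular_at_mult)

lemma regular_at_coeff_power:
  assumes "\<And>i. regular_at z (coeff f i)"
  shows "regular_at z (coeff (f ^ n) i)"
proof (induction n arbitrary: i)
  case 0
  then show ?case using regular_at_of_int[of z 0] regular_at_of_int[of z 1] by (simp add: coeff_1)
next
  case (Suc n)
  then show ?case using assms by (simp add: regular_at_coeff_mult)
qed

lemma regular_at_qvar_linear: "regular_at z (coeff [:1, qvar - 1:] i)"
proof -
  have "regular_at z (qvar - 1)"
    using regular_at_add[OF regular_at_qvar_power[of z 1] regular_at_of_int[of z "-1"]] by simp
  then show ?thesis
    using regular_at_of_int[of z 0] regular_at_of_int[of z 1]
    by (auto simp: coeff_pCons split: nat.splits)
qed

lemma qvar_neq_1: "qvar \<noteq> 1"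
  using qvar_powi_eq_1_iff[of 1] by simp

section \<open>Contributions of the vertices under a generic positive form\<close>

locale rational_polytope_form = rational_polytope_data P for P :: "(real ^ 'd) set" +
  fixes l :: "int ^ 'd"
  assumes generic: "generic_form P l" and positive: "positive_form P l"
begin

lemma form_V: "v \<in> W \<Longrightarrow> of_int (form l (V v)) = real p * form l v"
  by (simp add: rvec_V form_scaleR flip: form_rvec)

lemma form_V_nonneg: "v \<in> W \<Longrightarrow> 0 \<le> form l (V v)"
proof -
  assume v: "v \<in> W"
  then have "0 \<le> real p * form l v" using positive by (simp add: positive_form_def)
  then show ?thesis using form_V[OF v] by simp
qed

lemma edge_form:
  assumes "u \<in> set (edge_list v)"
  obtains w s where "adjacent P v w" "0 < s" "u = primitive_vec (V w - V v)"
    "real_of_int (form l u) = s * (form l w - form l v)"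
proof -
  obtain w where w: "adjacent P v w" "u = primitive_vec (V w - V v)"
    using assms by (auto simp: edge_list(2) edge_dirs_def)
  obtain s where s: "0 < s" "rvec u = s *\<^sub>R (w - v)"
    using primitive_edge[OF w(1)] w(2) by auto
  have "real_of_int (form l u) = s * (form l w - form l v)"
    using s(2) by (simp add: form_scaleR form_diff flip: form_rvec)
  then show ?thesis using that w s(1) by blast
qed

lemma edge_form_nonzero: "u \<in> set (edge_list v) \<Longrightarrow> form l u \<noteq> 0"
proof -
  assume u: "u \<in> set (edge_list v)"
  obtain w s where w: "adjacent P v w" "0 < s" "real_of_int (form l u) = s * (form l w - form l v)"
    using edge_form[OF u] by metis
  have "form l w \<noteq> form l v" using generic w(1) unfolding generic_form_def by metis
  then show ?thesis using w(2,3) by auto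
qed

definition denom :: "(int ^ 'd) list \<Rightarrow> ratfun" where
  "denom us = (\<Prod>u\<leftarrow>us. 1 - qvar powi form l u)"

lemma denom_append: "denom (us @ ws) = denom us * denom ws"
  by (simp add: denom_def)

lemma denom_nonzero: "(\<And>u. u \<in> set us \<Longrightarrow> form l u \<noteq> 0) \<Longrightarrow> denom us \<noteq> 0"
  by (induction us) (auto simp: denom_def qvar_powi_eq_1_iff eq_commute[of 1])

text \<open>The specialised generating function of \<open>r v + C v\<close>, defined as a quotient
  because the cone is in general infinite.\<close>

definition rho :: "nat \<Rightarrow> real ^ 'd \<Rightarrow> ratfun" where
  "rho r v = ev l (diffs (edge_list v) (indT v r)) / denom (edge_list v)"

text \<open>Brion's identity is specialised and \<open>denom us\<close>, nonzero by genericity, is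
  cancelled. Translation by \<open>k p v\<close> contributes a power of \<open>q^k\<close>, whose
  exponent is a natural number by positivity.\<close>

lemma ehr_eq_rho: "ehr P l (k * p + r) = (\<Sum>v\<in>W. rho r v * (qvar ^ k) ^ nat (form l (V v)))"
proof -
  obtain vs where vs: "distinct vs" "set vs = W" using finite_distinct_list[OF finite_W] by blast
  define t where "t = k * p + r"
  define us where "us = concat (map edge_list vs)"
  note brion = brion[OF vs t_def, folded us_def]
  have "form l u \<noteq> 0" if "u \<in> set us" for u
    using that edge_form_nonzero by (auto simp: us_def)
  then have nz: "denom us \<noteq> 0" by (rule denom_nonzero)
  have "denom us * ev l (indP t) = ev l (diffs us (indP t))"
    by (simp add: denom_def ev_diffs finsupp_indP)
  also have "diffs us (indP t) = (\<lambda>y. \<Sum>v\<in>W. diffs us (indT v t) y)"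
    using brion(1) by (rule ext)
  also have "ev l \<dots> = (\<Sum>v\<in>W. ev l (diffs us (indT v t)))"
    using brion(2) by (intro ev_sum finite_W)
  also have "\<dots> = (\<Sum>v\<in>W. denom us * (rho r v * (qvar ^ k) ^ nat (form l (V v))))"
  proof (rule sum.cong)
    fix v assume v: "v \<in> W"
    then have "v \<in> set vs" using vs by simp
    from split_list[OF this] obtain xs ys where xy: "vs = xs @ v # ys" by (elim exE)
    define as bs where "as = concat (map edge_list xs)" and "bs = concat (map edge_list ys)"
    have us: "us = as @ edge_list v @ bs" by (simp add: us_def xy as_def bs_def)
    let ?f = "diffs (edge_list v) (indT v t)"
    have "diffs us (indT v t) = diffs bs (diffs as ?f)"
      unfolding us diffs_append by (simp only: diffs_commute)
    then have "ev l (diffs us (indT v t)) = denom bs * (denom as * ev l ?f)"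
      by (simp add: denom_def ev_diffs finsupp_diffs finsupp_diffs_indT[OF v])
    moreover have "indT v t = (\<lambda>y. indT v r (y - nmul k (V v)))"
      by (rule ext) (simp add: t_def indT_shift[OF v])
    then have "?f = (\<lambda>y. diffs (edge_list v) (indT v r) (y - nmul k (V v)))"
      by (simp add: diffs_shift)
    then have "ev l ?f = qvar powi form l (nmul k (V v)) * ev l (diffs (edge_list v) (indT v r))"
      by (simp add: ev_shift)
    moreover have "qvar powi form l (nmul k (V v)) = (qvar ^ k) ^ nat (form l (V v))"
    proof -
      have "form l (nmul k (V v)) = int (k * nat (form l (V v)))"
        using form_V_nonneg[OF v] by (simp add: form_nmul)
      then show ?thesis by (simp only: power_int_of_nat power_mult)
    qed
    moreover have "denom (edge_list v) \<noteq> 0" using edge_form_nonzero by (intro denom_nonzero) auto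
    ultimately show "ev l (diffs us (indT v t))
        = denom us * (rho r v * (qvar ^ k) ^ nat (form l (V v)))"
      by (simp add: us denom_append rho_def)
  qed simp
  finally have "denom us * ev l (indP t) = denom us * (\<Sum>v\<in>W. rho r v * (qvar ^ k) ^ nat (form l (V v)))"
    by (simp add: sum_distrib_left)
  then have "ev l (indP t) = (\<Sum>v\<in>W. rho r v * (qvar ^ k) ^ nat (form l (V v)))"
    using nz by simp
  moreover have "ev l (indP t) = ehr P l t"
    by (simp add: ev_def indP_def ehr_def)
  ultimately show ?thesis by (simp add: t_def)
qed

text \<open>By the support bound and positivity, all exponents of the numerator are at least the sum
  \<open>m\<close> of the negative edge values. So \<open>q^m\<close> can be taken out and
  distributed over the edge factors, which prevents a pole at 0.\<close>

lemma rho_regular: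
  assumes v: "v \<in> W" and z: "\<And>u. u \<in> set (edge_list v) \<Longrightarrow> z ^ nat \<bar>form l u\<bar> \<noteq> 1"
  shows "regular_at z (rho r v)"
proof -
  let ?us = "edge_list v"
  define h where "h = diffs ?us (indT v r)"
  define m where "m = (\<Sum>u\<leftarrow>?us. min 0 (form l u))"
  have m: "m \<le> form l y" if "h y \<noteq> 0" for y
  proof -
    have "cone_diffs v (nmul p y - nmul r (V v)) \<noteq> 0" using that by (simp add: h_def diffs_indT[OF v])
    from cone_diffs_support[OF v this, of l]
    have "int p * m \<le> int p * form l y - int r * form l (V v)"
      by (simp add: m_def form_diff form_nmul)
    also have "\<dots> \<le> int p * form l y" using form_V_nonneg[OF v] by simp
    finally show ?thesis using p_pos by simp
  qed
  have ratio: "qvar powi (\<Sum>u\<leftarrow>us. min 0 (form l u)) / denom us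
      = (\<Prod>u\<leftarrow>us. qvar powi min 0 (form l u) / (1 - qvar powi form l u))" for us
  proof (induction us)
    case (Cons u us)
    have "qvar powi (\<Sum>u\<leftarrow>u # us. min 0 (form l u)) / denom (u # us)
        = qvar powi min 0 (form l u) / (1 - qvar powi form l u)
          * (qvar powi (\<Sum>u\<leftarrow>us. min 0 (form l u)) / denom us)"
      by (simp add: denom_def power_int_add qvar_nonzero)
    then show ?case by (simp only: Cons.IH list.map prod_list.Cons)
  qed (simp add: denom_def)
  have "ev l h = qvar powi m * (\<Sum>y\<in>{y. h y \<noteq> 0}. of_int (h y) * qvar ^ nat (form l y - m))"
    unfolding ev_def sum_distrib_left
  proof (rule sum.cong)
    fix y assume "y \<in> {y. h y \<noteq> 0}"
    then have "0 \<le> form l y - m" using m by simp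
    then have "qvar ^ nat (form l y - m) = qvar powi (form l y - m)" by (simp add: power_int_def)
    then have "qvar powi m * qvar ^ nat (form l y - m) = qvar powi form l y"
      by (simp add: qvar_nonzero flip: power_int_add)
    then show "of_int (h y) * qvar powi form l y = qvar powi m * (of_int (h y) * qvar ^ nat (form l y - m))"
      by (metis mult.left_commute)
  qed simp
  then have "rho r v = (\<Sum>y\<in>{y. h y \<noteq> 0}. of_int (h y) * qvar ^ nat (form l y - m))
      * (qvar powi m / denom ?us)"
    by (simp add: rho_def h_def mult.commute)
  also have "qvar powi m / denom ?us
      = (\<Prod>u\<leftarrow>?us. qvar powi min 0 (form l u) / (1 - qvar powi form l u))"
    unfolding m_def by (rule ratio)
  finally have eq: "rho r v = (\<Sum>y\<in>{y. h y \<noteq> 0}. of_int (h y) * qvar ^ nat (form l y - m))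
      * (\<Prod>u\<leftarrow>?us. qvar powi min 0 (form l u) / (1 - qvar powi form l u))" .
  show ?thesis
    unfolding eq using z
    by (intro regular_at_mult regular_at_sum regular_at_prod_list regular_at_of_int
        regular_at_qvar_power regular_at_edge_factor) auto
qed

text \<open>A lattice point of the affine hull gives coefficients of the \<open>w - v\<close> that
  may be negative. Adding \<open>N\<close> times the integral vectors \<open>p (w - v)\<close>, with
  \<open>N\<close> above the sum of their absolute values, makes all of them nonnegative.\<close>

lemma cone_point_exists:
  assumes "affine_lattice_point P r" "v \<in> W"
  shows "\<exists>y. rvec y - of_nat r *\<^sub>R v \<in> C v"
proof -
  obtain m where "rvec m \<in> affine hull (dilate r P)" using assms(1) by (auto simp: affine_lattice_point_def)
  also have "affine hull (dilate r P) = (\<lambda>x. of_nat r *\<^sub>R x) ` (affine hull W)"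
  proof -
    have "affine hull (dilate r P) = (\<lambda>x. of_nat r *\<^sub>R x) ` (affine hull P)"
      unfolding dilate_def by (rule affine_hull_linear_image[symmetric]) (rule bounded_linear_scaleR_right)
    also have "affine hull P = affine hull W" by (subst P_eq) simp
    finally show ?thesis .
  qed
  finally obtain x where x: "x \<in> affine hull W" "rvec m = of_nat r *\<^sub>R x" by auto
  obtain c where c: "sum c W = 1" "(\<Sum>w\<in>W. c w *\<^sub>R w) = x"
    using x(1) by (auto simp: affine_hull_finite[OF finite_W])
  define N where "N = nat \<lceil>\<Sum>w\<in>W. \<bar>of_nat r * c w\<bar>\<rceil>"
  have N: "0 \<le> of_nat r * c w + of_nat (N * p)" if "w \<in> W" for w
  proof -
    have "\<bar>of_nat r * c w\<bar> \<le> (\<Sum>w\<in>W. \<bar>of_nat r * c w\<bar>)"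
      using that finite_W by (intro member_le_sum) auto
    also have "\<dots> \<le> of_nat N" unfolding N_def by linarith
    also have "\<dots> \<le> of_nat (N * p)" using p_pos by (intro of_nat_mono) simp
    finally show ?thesis by linarith
  qed
  have mem: "(\<Sum>w\<in>A. b w *\<^sub>R (w - v)) \<in> C v" if "finite A" "A \<subseteq> W" "\<And>w. w \<in> W \<Longrightarrow> 0 \<le> b w" for A b
    using that(1,2)
  proof (induction A rule: finite_induct)
    case empty
    then show ?case by (simp add: C_def convex_cone_hull_contains_0)
  next
    case (insert w A)
    have "b w *\<^sub>R (w - v) \<in> C v"
      unfolding C_def using insert.prems that(3)[of w]
      by (intro convex_cone_hull_mul hull_inc imageI) auto
    with insert show ?case by (simp add: C_add)
  qed
  define y where "y = m + nmul N (\<Sum>w\<in>W. V w - V v)"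
  have rs: "rvec (\<Sum>w\<in>A. V w - V v) = of_nat p *\<^sub>R (\<Sum>w\<in>A. w - v)" if "A \<subseteq> W" for A
    using finite_subset[OF that finite_W] that
    by (induction A rule: finite_induct)
      (simp_all add: rvec_0 rvec_add rvec_diff rvec_V assms(2) scaleR_right_distrib scaleR_diff_right)
  have "rvec y = of_nat r *\<^sub>R x + of_nat (N * p) *\<^sub>R (\<Sum>w\<in>W. w - v)"
    by (simp add: y_def rvec_add rvec_nmul rs x(2))
  moreover have "of_nat r *\<^sub>R x - of_nat r *\<^sub>R v = (\<Sum>w\<in>W. (of_nat r * c w) *\<^sub>R (w - v))"
  proof -
    have "(\<Sum>w\<in>W. (of_nat r * c w) *\<^sub>R (w - v))
        = of_nat r *\<^sub>R ((\<Sum>w\<in>W. c w *\<^sub>R w) - sum c W *\<^sub>R v)"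
      by (simp add: scaleR_sum_right scaleR_sum_left scaleR_diff_right sum_subtractf)
    then show ?thesis by (simp add: c scaleR_diff_right)
  qed
  ultimately have "rvec y - of_nat r *\<^sub>R v
      = (\<Sum>w\<in>W. (of_nat r * c w) *\<^sub>R (w - v)) + of_nat (N * p) *\<^sub>R (\<Sum>w\<in>W. w - v)"
    by (simp add: algebra_simps)
  also have "\<dots> = (\<Sum>w\<in>W. (of_nat r * c w + of_nat (N * p)) *\<^sub>R (w - v))"
    by (simp only: scaleR_left_distrib sum.distrib scaleR_sum_right)
  also have "\<dots> \<in> C v" using N by (intro mem finite_W) auto
  finally show ?thesis by blast
qed

text \<open>By genericity the form strictly decreases along every edge leaving a maximal vertex, and
  the edges generate the tangent cone. In particular, the maximal vertex is unique.\<close>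

lemma top_vertex:
  assumes "v \<in> W" "\<And>w. w \<in> W \<Longrightarrow> form l w \<le> form l v"
  shows "u \<in> set (edge_list v) \<Longrightarrow> form l u < 0"
    and "x \<in> C v \<Longrightarrow> x = 0 \<or> form l x < (0::real)"
proof -
  have lt: "form l w < form l v" if "adjacent P v w" for w
    using that generic assms(2) adjacent_W[OF that] by (force simp: generic_form_def)
  show "form l u < 0" if u: "u \<in> set (edge_list v)"
  proof -
    obtain w s where w: "adjacent P v w" "0 < s" "real_of_int (form l u) = s * (form l w - form l v)"
      using edge_form[OF u] by metis
    have "s * (form l w - form l v) < 0" using lt[OF w(1)] w(2) by (intro mult_pos_neg) auto
    then show ?thesis using w(3) by simp
  qed
  have "C v \<subseteq> {x. x = 0 \<or> form l x < 0}"
    unfolding C_def tangent_cone_edges[OF P_eq refl assms(1) finite_W]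
  proof (rule hull_minimal)
    show "(\<lambda>w. w - v) ` {w. adjacent P v w} \<subseteq> {x. x = 0 \<or> form l x < 0}"
      using lt by (auto simp: form_diff)
    show "convex_cone {x. x = 0 \<or> form l x < (0::real)}"
      unfolding convex_cone_iff
      by (auto simp: form_add form_scaleR form_0 mult_less_0_iff)
  qed
  then show "x \<in> C v \<Longrightarrow> x = 0 \<or> form l x < (0::real)" by auto
qed

text \<open>On the lattice points of \<open>r v + C v\<close> the form attains a maximum
  \<open>m\<close>. At that level the differences change nothing, so the coefficient of
  \<open>q^m\<close> in the numerator counts lattice points and is positive.\<close>

lemma rho_nonzero:
  assumes "affine_lattice_point P r" "v \<in> W" "\<And>w. w \<in> W \<Longrightarrow> form l w \<le> form l v"
  shows "rho r v \<noteq> 0"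
proof -
  define h where "h = diffs (edge_list v) (indT v r)"
  define T where "T = {y. rvec y - of_nat r *\<^sub>R v \<in> C v}"
  let ?b = "\<lfloor>of_nat r * form l v\<rfloor>"
  have le: "form l y \<le> ?b" if "y \<in> T" for y
  proof -
    have "rvec y - of_nat r *\<^sub>R v \<in> C v" using that by (simp add: T_def)
    then have "rvec y - of_nat r *\<^sub>R v = 0 \<or> form l (rvec y - of_nat r *\<^sub>R v) < (0::real)"
      using assms(2,3) by (intro top_vertex(2)) auto
    then have "form l (rvec y - of_nat r *\<^sub>R v) \<le> (0::real)" by (auto simp: form_0)
    then have "of_int (form l y) \<le> of_nat r * form l v"
      by (simp add: form_diff form_scaleR form_rvec)
    then show ?thesis by (simp add: le_floor_iff)
  qed
  obtain y0 where y0: "y0 \<in> T" using cone_point_exists[OF assms(1,2)] by (auto simp: T_def)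
  \<comment> \<open>The form is bounded by \<open>?b\<close> on \<open>T\<close>, so minimising this
    natural number maximises the form.\<close>
  obtain y1 where y1: "y1 \<in> T" "\<And>y. y \<in> T \<Longrightarrow> nat (?b - form l y1) \<le> nat (?b - form l y)"
    using ex_has_least_nat[of "\<lambda>y. y \<in> T" y0 "\<lambda>y. nat (?b - form l y)"] y0 by auto
  define m where "m = form l y1"
  have max: "form l y \<le> m" if "y \<in> T" for y
    using y1(2)[OF that] le[OF that] le[OF y1(1)] by (simp add: m_def)
  have top: "h y = indT v r y" if "m \<le> form l y" for y
    unfolding h_def
  proof (rule diffs_top[where lam = "form l" and m = m])
    show "form l (x - y) = form l x - form l y" for x y :: "int ^ 'd" by (rule form_diff)
    show "form l u < 0" if "u \<in> set (edge_list v)" for u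
      using top_vertex(1)[OF assms(2,3) that] .
    show "indT v r y = 0" if "m < form l y" for y
      using max[of y] that by (auto simp: indT_def T_def)
  qed (fact that)
  have fin: "finite {y. h y \<noteq> 0}" using finsupp_diffs_indT[OF assms(2)] by (simp add: h_def finsupp_def)
  have "h y1 = 1" using top[of y1] y1(1) by (simp add: m_def indT_def T_def)
  then have "0 < (\<Sum>y\<in>{y\<in>{y. h y \<noteq> 0}. form l y = m}. h y)"
    using fin top by (intro sum_pos2[of _ y1]) (auto simp: m_def indT_def)
  then have "(\<Sum>y\<in>{y. h y \<noteq> 0}. of_int (h y) * qvar powi form l y) \<noteq> 0"
    by (intro qvar_sum_nonzero[OF fin, where m = m]) auto
  then have "ev l h \<noteq> 0" by (simp add: ev_def)
  then show ?thesis
    using denom_nonzero[of "edge_list v"] edge_form_nonzero by (auto simp: rho_def h_def)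
qed

section \<open>Interpolation, degree and poles\<close>

definition chi :: "nat \<Rightarrow> ratfun poly" where
  "chi r = (\<Sum>v\<in>W. smult (rho r v) ([:1, qvar - 1:] ^ nat (form l (V v))))"

lemma poly_chi: "poly (chi r) (qint k) = ehr P l (k * p + r)"
proof -
  have "1 + qint k * (qvar - 1) = qvar ^ k" using qvar_neq_1 by (simp add: qint_def)
  then show ?thesis
    by (simp add: chi_def poly_sum ehr_eq_rho)
qed

text \<open>The summand of the unique maximal vertex has strictly larger exponent than all others
  and a nonzero factor \<open>rho r v\<close>, so its leading term survives.\<close>

lemma degree_chi:
  assumes "affine_lattice_point P r"
  shows "real (degree (chi r)) = Max ((\<lambda>v. form l (of_nat p *\<^sub>R v)) ` W)"
proof -
  obtain v where v: "v \<in> W" "\<And>w. w \<in> W \<Longrightarrow> form l w \<le> form l v"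
  proof -
    have "Max (form l ` W) \<in> form l ` W" using finite_W W_nonempty by (intro Max_in) auto
    then obtain v where "v \<in> W" "form l v = Max (form l ` W)" by (metis imageE)
    then show ?thesis using that[of v] finite_W by simp
  qed
  define a where "a w = nat (form l (V w))" for w
  have a: "real (a w) = real p * form l w" if "w \<in> W" for w
    using form_V[OF that] form_V_nonneg[OF that] by (simp add: a_def)
  have lt: "a w < a v" if "w \<in> W" "w \<noteq> v" for w
  proof -
    have "w - v \<in> C v" unfolding C_def using that by (intro hull_inc imageI)
    then have "form l (w - v) < (0::real)" using top_vertex(2)[OF v, of "w - v"] that by simp
    then have "real p * form l w < real p * form l v" using p_pos by (simp add: form_diff)
    then have "real (a w) < real (a v)" using a[OF that(1)] a[OF v(1)] by simp
    then show ?thesis by simp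
  qed
  have deg: "degree ([:1, qvar - 1:] ^ n) = n" and lead: "coeff ([:1, qvar - 1:] ^ n) n = (qvar - 1) ^ n" for n
  proof -
    show d: "degree ([:1, qvar - 1:] ^ n) = n" using qvar_neq_1 by (simp add: degree_power_eq)
    show "coeff ([:1, qvar - 1:] ^ n) n = (qvar - 1) ^ n"
      using lead_coeff_power[of "[:1, qvar - 1:]" n] d qvar_neq_1 by simp
  qed
  have "coeff (chi r) (a v) = (\<Sum>w\<in>W. if w = v then rho r v * (qvar - 1) ^ a v else 0)"
    unfolding chi_def coeff_sum
  proof (rule sum.cong)
    fix w assume w: "w \<in> W"
    show "coeff (smult (rho r w) ([:1, qvar - 1:] ^ nat (form l (V w)))) (a v)
        = (if w = v then rho r v * (qvar - 1) ^ a v else 0)"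
    proof (cases "w = v")
      case True
      then show ?thesis by (simp add: lead flip: a_def)
    next
      case False
      then have "coeff ([:1, qvar - 1:] ^ a w) (a v) = 0"
        using lt[OF w] by (intro coeff_eq_0) (simp add: deg)
      then show ?thesis using False by (simp flip: a_def)
    qed
  qed simp
  also have "\<dots> = rho r v * (qvar - 1) ^ a v" using finite_W v(1) by simp
  also have "\<dots> \<noteq> 0" using rho_nonzero[OF assms v] qvar_neq_1 by simp
  finally have "a v \<le> degree (chi r)" by (rule le_degree)
  moreover have "degree (chi r) \<le> a v"
    unfolding chi_def
  proof (rule degree_sum_le[OF finite_W])
    fix w assume w: "w \<in> W"
    have "a w \<le> a v" using lt[OF w] by (cases "w = v") auto
    then show "degree (smult (rho r w) ([:1, qvar - 1:] ^ nat (form l (V w)))) \<le> a v"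
      using degree_smult_le[of "rho r w" "[:1, qvar - 1:] ^ a w"] by (simp add: deg flip: a_def)
  qed
  ultimately have "degree (chi r) = a v" by simp
  then have "real (degree (chi r)) = form l (of_nat p *\<^sub>R v)" by (simp add: a[OF v(1)] form_scaleR)
  also have "\<dots> = Max ((\<lambda>v. form l (of_nat p *\<^sub>R v)) ` W)"
    using finite_W v by (intro Max_eqI[symmetric]) (auto simp: form_scaleR intro!: mult_left_mono)
  finally show ?thesis .
qed

text \<open>Away from the roots of unity attached to the edges every \<open>rho r v\<close> is
  regular, and the powers of \<open>1 + (q - 1) x\<close> have polynomial coefficients. The lattice
  vector \<open>u\<close> is \<open>V w - V v\<close>.\<close>

lemma poles_chi:
  assumes "is_pole_of z (coeff (chi r) i)"
  shows "\<exists>v w u. adjacent P v w \<and> rvec u = of_nat p *\<^sub>R (w - v) \<and>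
    z ^ nat \<bar>form l (primitive_vec u)\<bar> = 1"
proof (rule ccontr)
  assume no: "\<not> ?thesis"
  have "z ^ nat \<bar>form l u\<bar> \<noteq> 1" if u: "u \<in> set (edge_list v)" for u v
  proof -
    obtain w where "adjacent P v w" "u = primitive_vec (V w - V v)"
      using u by (auto simp: edge_list(2) edge_dirs_def)
    then show ?thesis using no rvec_edge by blast
  qed
  then have "regular_at z (coeff (chi r) i)"
    unfolding chi_def coeff_sum coeff_smult
    by (intro regular_at_sum regular_at_mult rho_regular regular_at_coeff_power regular_at_qvar_linear) auto
  with assms show False using regular_at_not_pole by blast
qed

end

theorem theorem1p10:
  fixes P :: "(real ^ 'd) set" and l :: "int ^ 'd" and p r :: nat
  assumes "rational_polytope P"
    and "p = denominator P"
    and "generic_form P l"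
    and "positive_form P l"
    and "r < p"
  shows "\<exists>ch :: ratfun poly.
    (\<forall>k. poly ch (qint k) = ehr P l (k * p + r)) \<and>
    (affine_lattice_point P r \<longrightarrow>
      real (degree ch) = Max ((\<lambda>v. form l (of_nat p *\<^sub>R v)) ` vertices P)) \<and>
    (\<forall>i z. is_pole_of z (coeff ch i) \<longrightarrow>
      (\<exists>v w u. adjacent P v w \<and> rvec u = of_nat p *\<^sub>R (w - v) \<and>
        z ^ nat \<bar>form l (primitive_vec u)\<bar> = 1))"
proof -
  interpret rational_polytope_form P l
    using assms by unfold_locales
  have p: "rational_polytope_data.p P = p" by (simp add: p_def assms(2))
  show ?thesis
    using poly_chi[of r] degree_chi[of r] poles_chi[of _ r] unfolding p by blast
qed

end
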